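(* The affinity partial coherence $C^a_A$ is a partial coherence measure, i.e. it satisfies: (C1) $C^a_A(\rho^{ab})\ge0$ with equality iff $\rho^{ab}\in I^a_P$; (C2) $C^a_A(\Phi^a(\rho^{ab}))\le C^a_A(\rho^{ab})$ for every partial incoherent operation $\Phi^a$; (C3) $\sum_ip_iC^a_A(p_i^{-1}K_i\rho^{ab}K_i^\dagger)\le C^a_A(\rho^{ab})$, where $\{K_i\}$ are Kraus operators of a partial incoherent operation and $p_i=\mathrm{Tr}(K_i\rho^{ab}K_i^\dagger)$ (sum over $p_i>0$); (C4) $C^a_A(\sum_ip_i\rho^{ab}_i)\le\sum_ip_iC^a_A(\rho^{ab}_i)$ for every ensemble $\{p_i,\rho^{ab}_i\}$.
   Context: Bipartite finite-dimensional system $\mathcal H_a\otimes\mathcal H_b$ with a fixed orthonormal basis $\{|i\rangle\}$ of $\mathcal H_a$. Partial incoherent states: $I^a_P=\{\sigma:\sum_i(|i\rangle\langle i|\otimes I^b)\sigma(|i\rangle\langle i|\otimes I^b)=\sigma\}$. A CPTP map with Kraus operators $\{K_n\}$ is a partial incoherent operation if each $K_n$ maps $I^a_P$ into (nonnegative multiples of elements of) $I^a_P$, i.e. $K_n\sigma K_n^\dagger/\mathrm{Tr}(K_n\sigma K_n^\dagger)\in I^a_P$ whenever $\sigma\in I^a_P$ and $K_n\sigma K_n^\dagger\ne0$. $C^a_A(\rho^{ab})=\min_{\sigma\in I^a_P}(1-A^2(\rho^{ab},\sigma))$ with $A(\rho,\sigma)=\mathrm{Tr}(\sqrt\rho\sqrt\sigma)$.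 *)

theory Defs
  imports "Jordan_Normal_Form.Matrix"
begin

definition dagger :: "complex mat \<Rightarrow> complex mat" where
  "dagger A = mat (dim_col A) (dim_row A) (\<lambda>(i,j). cnj (A $$ (j,i)))"

definition mtrace :: "complex mat \<Rightarrow> complex" where
  "mtrace A = (\<Sum>i<dim_row A. A $$ (i,i))"

definition mat_sum :: "nat \<Rightarrow> 'i set \<Rightarrow> ('i \<Rightarrow> complex mat) \<Rightarrow> complex mat" where
  "mat_sum n I F = mat n n (\<lambda>(r,c). \<Sum>k\<in>I. F k $$ (r,c))"

definition hermitian :: "complex mat \<Rightarrow> bool" where
  "hermitian A \<longleftrightarrow> dim_row A = dim_col A \<and> dagger A = A"

definition psd :: "nat \<Rightarrow> complex mat \<Rightarrow> bool" where
  "psd n A \<longleftrightarrow> A \<in> carrier_mat n n \<and> hermitian A \<and>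
     (\<forall>v \<in> carrier_vec n. 0 \<le> Re (conjugate v \<bullet> (A *\<^sub>v v)))"

definition msqrt :: "nat \<Rightarrow> complex mat \<Rightarrow> complex mat" where
  "msqrt n A = (THE B. psd n B \<and> B * B = A)"

definition density :: "nat \<Rightarrow> complex mat \<Rightarrow> bool" where
  "density n \<rho> \<longleftrightarrow> psd n \<rho> \<and> mtrace \<rho> = 1"

(* affinity A(rho,sigma) = Tr(sqrt rho sqrt sigma) (a real number for psd arguments) *)
definition affinity :: "nat \<Rightarrow> complex mat \<Rightarrow> complex mat \<Rightarrow> real" where
  "affinity n \<rho> \<sigma> = Re (mtrace (msqrt n \<rho> * msqrt n \<sigma>))"

(* H_a \<otimes> H_b with dim H_a = da, dim H_b = db; basis vector |i>|k> has index i*db + k.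
   proj_a da db i = |i><i| \<otimes> I^b *)
definition proj_a :: "nat \<Rightarrow> nat \<Rightarrow> nat \<Rightarrow> complex mat" where
  "proj_a da db i = mat (da*db) (da*db) (\<lambda>(r,c). if r = c \<and> r div db = i then 1 else 0)"

definition dephase_a :: "nat \<Rightarrow> nat \<Rightarrow> complex mat \<Rightarrow> complex mat" where
  "dephase_a da db \<sigma> = mat_sum (da*db) {..<da} (\<lambda>i. proj_a da db i * \<sigma> * proj_a da db i)"

definition IP :: "nat \<Rightarrow> nat \<Rightarrow> complex mat set" where
  "IP da db = {\<sigma>. density (da*db) \<sigma> \<and> dephase_a da db \<sigma> = \<sigma>}"

definition CA :: "nat \<Rightarrow> nat \<Rightarrow> complex mat \<Rightarrow> real" where
  "CA da db \<rho> = (INF \<sigma>\<in>IP da db. 1 - (affinity (da*db) \<rho> \<sigma>)\<^sup>2)"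

definition kraus :: "nat \<Rightarrow> nat \<Rightarrow> (nat \<Rightarrow> complex mat) \<Rightarrow> bool" where
  "kraus n r K \<longleftrightarrow> (\<forall>i<r. K i \<in> carrier_mat n n) \<and>
     mat_sum n {..<r} (\<lambda>i. dagger (K i) * K i) = 1\<^sub>m n"

definition apply_kraus :: "nat \<Rightarrow> nat \<Rightarrow> (nat \<Rightarrow> complex mat) \<Rightarrow> complex mat \<Rightarrow> complex mat" where
  "apply_kraus n r K \<rho> = mat_sum n {..<r} (\<lambda>i. K i * \<rho> * dagger (K i))"

definition PIO :: "nat \<Rightarrow> nat \<Rightarrow> nat \<Rightarrow> (nat \<Rightarrow> complex mat) \<Rightarrow> bool" where
  "PIO da db r K \<longleftrightarrow> kraus (da*db) r K \<and>
     (\<forall>i<r. \<forall>\<sigma>\<in>IP da db. K i * \<sigma> * dagger (K i) \<noteq> 0\<^sub>m (da*db) (da*db) \<longrightarrow>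
        (of_real (1 / Re (mtrace (K i * \<sigma> * dagger (K i)))) \<cdot>\<^sub>m (K i * \<sigma> * dagger (K i)))
          \<in> IP da db)"

end

theory Submission
  imports Defs "Jordan_Normal_Form.Spectral_Radius" "HOL-Analysis.L2_Norm"
begin

text \<open>Write \<open>\<Delta>\<close> for the dephasing map. If \<open>\<sigma>\<close> is block diagonal, so is \<open>\<surd>\<sigma>\<close>, hence
  \<open>Tr(\<surd>\<rho> \<surd>\<sigma>) = Tr(\<Delta>(\<surd>\<rho>) \<surd>\<sigma>)\<close>; by Cauchy-Schwarz this is maximal for \<open>\<surd>\<sigma>\<close> proportional to
  \<open>\<Delta>(\<surd>\<rho>)\<close>, and the coherence equals \<open>1 - Tr(\<Delta>(\<surd>\<rho>)\<^sup>2)\<close>. Faithfulness is then Pythagoras for the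
  Hilbert-Schmidt norm. Strong monotonicity and convexity follow from Kraus monotonicity
  \<open>Tr(\<surd>\<rho> \<surd>\<sigma>) \<le> \<Sum>\<^sub>k Tr(\<surd>(K\<^sub>k \<rho> K\<^sub>k\<^sup>*) \<surd>(K\<^sub>k \<sigma> K\<^sub>k\<^sup>*))\<close> and superadditivity of the affinity, applied with
  the optimal \<open>\<sigma>\<close>; together they give monotonicity. Both properties of the affinity (special cases
  of Lieb's theorem) come from writing it as an integral over \<open>u > 0\<close> of minima over \<open>Z\<close> of
  \<open>Tr(Z\<^sup>* \<rho> Z) + u\<^sup>2 Tr((1 - Z) \<sigma> (1 - Z)\<^sup>*)\<close>, which is linear in \<open>(\<rho>, \<sigma>)\<close>.\<close>

subsection \<open>Adjoints, traces and the Hilbert-Schmidt norm\<close>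

lemma dagger_carrier[simp]: "A \<in> carrier_mat m n \<Longrightarrow> dagger A \<in> carrier_mat n m"
  by (auto simp: dagger_def)

lemma dim_dagger[simp]: "dim_row (dagger A) = dim_col A" "dim_col (dagger A) = dim_row A"
  by (auto simp: dagger_def)

lemma index_dagger[simp]:
  "i < dim_col A \<Longrightarrow> j < dim_row A \<Longrightarrow> dagger A $$ (i,j) = cnj (A $$ (j,i))"
  by (auto simp: dagger_def)

lemma dagger_dagger[simp]: "dagger (dagger A) = A"
  by (rule eq_matI) auto

lemma dagger_mult:
  assumes "A \<in> carrier_mat m n" "B \<in> carrier_mat n k"
  shows "dagger (A * B) = dagger B * dagger A"
  by (rule eq_matI) (use assms in \<open>auto simp: scalar_prod_def mult.commute\<close>)

lemma dagger_smult: "dagger (c \<cdot>\<^sub>m A) = cnj c \<cdot>\<^sub>m dagger A"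
  by (rule eq_matI) auto

section \<open>Finite sums of square matrices\<close>

lemma mat_sum_carrier[simp]: "mat_sum n I F \<in> carrier_mat n n"
  by (simp add: mat_sum_def)

lemma index_mat_sum[simp]: "i < n \<Longrightarrow> j < n \<Longrightarrow> mat_sum n I F $$ (i,j) = (\<Sum>k\<in>I. F k $$ (i,j))"
  by (simp add: mat_sum_def)

lemma mat_sum_cong: "(\<And>k. k \<in> I \<Longrightarrow> F k = G k) \<Longrightarrow> mat_sum n I F = mat_sum n I G"
  unfolding mat_sum_def by (intro arg_cong[where f = "mat n n"]) (auto intro!: sum.cong)

lemma dagger_mat_sum:
  assumes F: "\<And>k. k \<in> I \<Longrightarrow> F k \<in> carrier_mat n n"
  shows "dagger (mat_sum n I F) = mat_sum n I (\<lambda>k. dagger (F k))"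
proof (rule eq_matI)
  fix i j assume "i < dim_row (mat_sum n I (\<lambda>k. dagger (F k)))" "j < dim_col (mat_sum n I (\<lambda>k. dagger (F k)))"
  then have ij: "i < n" "j < n" by (auto simp: mat_sum_def)
  have "dagger (F k) $$ (i,j) = cnj (F k $$ (j,i))" if "k \<in> I" for k
    using F[OF that] ij by simp
  with ij show "dagger (mat_sum n I F) $$ (i,j) = mat_sum n I (\<lambda>k. dagger (F k)) $$ (i,j)"
    by (simp add: mat_sum_def)
qed (auto simp: mat_sum_def)

lemma mult_mat_sum_left:
  assumes A: "A \<in> carrier_mat n n" and F: "\<And>k. k \<in> I \<Longrightarrow> F k \<in> carrier_mat n n"
  shows "A * mat_sum n I F = mat_sum n I (\<lambda>k. A * F k)"
proof (rule eq_matI)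
  fix i j assume "i < dim_row (mat_sum n I (\<lambda>k. A * F k))" "j < dim_col (mat_sum n I (\<lambda>k. A * F k))"
  then have ij: "i < n" "j < n" by (auto simp: mat_sum_def)
  have "(A * mat_sum n I F) $$ (i,j) = (\<Sum>l=0..<n. \<Sum>k\<in>I. A $$ (i,l) * F k $$ (l,j))"
    using A ij by (simp add: scalar_prod_def mat_sum_def sum_distrib_left)
  also have "\<dots> = (\<Sum>k\<in>I. \<Sum>l=0..<n. A $$ (i,l) * F k $$ (l,j))"
    by (rule sum.swap)
  also have "\<dots> = (\<Sum>k\<in>I. (A * F k) $$ (i,j))"
  proof (rule sum.cong[OF refl])
    fix k assume "k \<in> I"
    from F[OF this] show "(\<Sum>l=0..<n. A $$ (i,l) * F k $$ (l,j)) = (A * F k) $$ (i,j)"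
      using A ij by (simp add: scalar_prod_def)
  qed
  finally show "(A * mat_sum n I F) $$ (i,j) = mat_sum n I (\<lambda>k. A * F k) $$ (i,j)"
    using ij by simp
qed (use A in \<open>auto simp: mat_sum_def\<close>)

lemma mult_mat_sum_right:
  assumes A: "A \<in> carrier_mat n n" and F: "\<And>k. k \<in> I \<Longrightarrow> F k \<in> carrier_mat n n"
  shows "mat_sum n I F * A = mat_sum n I (\<lambda>k. F k * A)"
proof -
  have "dagger (mat_sum n I (\<lambda>k. F k * A)) = mat_sum n I (\<lambda>k. dagger (F k * A))"
    using assms by (intro dagger_mat_sum mult_carrier_mat)
  also have "\<dots> = mat_sum n I (\<lambda>k. dagger A * dagger (F k))"
    using assms by (intro mat_sum_cong) (auto simp: dagger_mult[of _ n n])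
  also have "\<dots> = dagger A * dagger (mat_sum n I F)"
    using assms by (simp add: dagger_mat_sum mult_mat_sum_left)
  also have "\<dots> = dagger (mat_sum n I F * A)"
    using A by (simp add: dagger_mult[of _ n n])
  finally have "dagger (mat_sum n I F * A) = dagger (mat_sum n I (\<lambda>k. F k * A))" ..
  then show ?thesis by (metis dagger_dagger)
qed

lemma mat_sum_minus:
  assumes "\<And>k. k \<in> I \<Longrightarrow> F k \<in> carrier_mat n n" "\<And>k. k \<in> I \<Longrightarrow> G k \<in> carrier_mat n n"
  shows "mat_sum n I (\<lambda>k. F k - G k) = mat_sum n I F - mat_sum n I G"
  proof (rule eq_matI)
  fix i j assume "i < dim_row (mat_sum n I F - mat_sum n I G)" "j < dim_col (mat_sum n I F - mat_sum n I G)"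
  then have ij: "i < n" "j < n" by (auto simp: mat_sum_def)
  have "(F k - G k) $$ (i,j) = F k $$ (i,j) - G k $$ (i,j)" if "k \<in> I" for k
    using assms[OF that] ij by simp
  with ij show "mat_sum n I (\<lambda>k. F k - G k) $$ (i,j) = (mat_sum n I F - mat_sum n I G) $$ (i,j)"
    by (simp add: mat_sum_def sum_subtractf)
qed (auto simp: mat_sum_def)

section \<open>Trace identities and the Hilbert-Schmidt inner product\<close>

lemma mtrace_mult_comm:
  assumes "A \<in> carrier_mat m n" "B \<in> carrier_mat n m"
  shows "mtrace (A * B) = mtrace (B * A)"
proof -
  have "mtrace (A * B) = (\<Sum>i<m. \<Sum>j<n. A $$ (i,j) * B $$ (j,i))"
    unfolding mtrace_def using assms
    by (auto simp: scalar_prod_def lessThan_atLeast0 intro!: sum.cong)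
  also have "\<dots> = (\<Sum>j<n. \<Sum>i<m. B $$ (j,i) * A $$ (i,j))"
    by (subst sum.swap) (simp add: mult.commute)
  also have "\<dots> = mtrace (B * A)"
    unfolding mtrace_def using assms
    by (auto simp: scalar_prod_def lessThan_atLeast0 intro!: sum.cong)
  finally show ?thesis .
qed

lemma mtrace_smult: "A \<in> carrier_mat n n \<Longrightarrow> mtrace (c \<cdot>\<^sub>m A) = c * mtrace A"
  by (auto simp: mtrace_def sum_distrib_left intro!: sum.cong)

lemma mtrace_mat_sum:
  assumes "\<And>k. k \<in> I \<Longrightarrow> F k \<in> carrier_mat n n"
  shows "mtrace (mat_sum n I F) = (\<Sum>k\<in>I. mtrace (F k))"
proof -
  have "mtrace (mat_sum n I F) = (\<Sum>i<n. \<Sum>k\<in>I. F k $$ (i,i))"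
    unfolding mtrace_def by (auto simp: mat_sum_def)
  also have "\<dots> = (\<Sum>k\<in>I. mtrace (F k))"
    unfolding mtrace_def using assms by (subst sum.swap) (auto intro!: sum.cong)
  finally show ?thesis .
qed

text \<open>The squared Hilbert-Schmidt (Frobenius) norm; squared, it is additive over entries and
  equal to a trace.\<close>

definition hs2 :: "complex mat \<Rightarrow> real" where
  "hs2 A = (\<Sum>i<dim_row A. \<Sum>j<dim_col A. (cmod (A $$ (i,j)))\<^sup>2)"

lemma hs2_nonneg: "hs2 A \<ge> 0"
  unfolding hs2_def by (intro sum_nonneg) auto

lemma hs2_eq_0:
  assumes "A \<in> carrier_mat m n" "hs2 A = 0"
  shows "A = 0\<^sub>m m n"
proof (rule eq_matI)
  fix i j assume ij: "i < dim_row (0\<^sub>m m n :: complex mat)" "j < dim_col (0\<^sub>m m n :: complex mat)"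
  have "\<forall>i<dim_row A. (\<Sum>j<dim_col A. (cmod (A $$ (i,j)))\<^sup>2) = 0"
    using assms(2) unfolding hs2_def
    by (subst (asm) sum_nonneg_eq_0_iff) (auto intro: sum_nonneg)
  then have "\<forall>i<dim_row A. \<forall>j<dim_col A. (cmod (A $$ (i,j)))\<^sup>2 = 0"
    by (subst (asm) sum_nonneg_eq_0_iff) auto
  with ij assms(1) show "A $$ (i,j) = 0\<^sub>m m n $$ (i,j)" by auto
qed (use assms in auto)

lemma mtrace_mult_dagger:
  assumes "A \<in> carrier_mat m n" "B \<in> carrier_mat m n"
  shows "mtrace (A * dagger B) = (\<Sum>i<m. \<Sum>j<n. A $$ (i,j) * cnj (B $$ (i,j)))"
  unfolding mtrace_def using assms
  by (auto simp: scalar_prod_def lessThan_atLeast0 intro!: sum.cong)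

lemma mtrace_self_dagger: "mtrace (A * dagger A) = of_real (hs2 A)"
  by (subst mtrace_mult_dagger[of _ "dim_row A" "dim_col A"])
     (auto simp: hs2_def complex_norm_square simp flip: of_real_power intro!: sum.cong)

lemma hs2_dagger[simp]: "hs2 (dagger A) = hs2 A"
  unfolding hs2_def by (subst sum.swap) auto

lemma mtrace_dagger_self: "mtrace (dagger A * A) = of_real (hs2 A)"
  using mtrace_self_dagger[of "dagger A"] by simp

text \<open>A matrix is read as a vector indexed by pairs of positions, and the trace as the inner
  product of two such vectors.\<close>

lemma mtrace_Cauchy_Schwarz:
  assumes "A \<in> carrier_mat m n" "B \<in> carrier_mat m n"
  shows "Re (mtrace (A * dagger B)) \<le> sqrt (hs2 A) * sqrt (hs2 B)"
proof -
  let ?S = "{..<m} \<times> {..<n}"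
  have "Re (mtrace (A * dagger B)) = (\<Sum>x\<in>?S. Re (A $$ x * cnj (B $$ x)))"
    by (simp add: mtrace_mult_dagger[OF assms] sum.cartesian_product case_prod_beta)
  also have "\<dots> \<le> (\<Sum>x\<in>?S. cmod (A $$ x) * cmod (B $$ x))"
    by (intro sum_mono) (metis complex_Re_le_cmod complex_mod_cnj norm_mult)
  also have "\<dots> \<le> (\<Sum>x\<in>?S. \<bar>cmod (A $$ x)\<bar> * \<bar>cmod (B $$ x)\<bar>)"
    by simp
  also have "\<dots> \<le> sqrt (\<Sum>x\<in>?S. (cmod (A $$ x))\<^sup>2) * sqrt (\<Sum>x\<in>?S. (cmod (B $$ x))\<^sup>2)"
    using L2_set_mult_ineq[of "\<lambda>x. cmod (A $$ x)" "\<lambda>x. cmod (B $$ x)" ?S]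
    unfolding L2_set_def .
  also have "\<dots> = sqrt (hs2 A) * sqrt (hs2 B)"
    using assms unfolding hs2_def by (auto simp: sum.cartesian_product case_prod_beta)
  finally show ?thesis .
qed

subsection \<open>The spectral theorem\<close>

definition unitary :: "nat \<Rightarrow> complex mat \<Rightarrow> bool" where
  "unitary n U \<longleftrightarrow> U \<in> carrier_mat n n \<and> dagger U * U = 1\<^sub>m n \<and> U * dagger U = 1\<^sub>m n"

definition rdiag :: "nat \<Rightarrow> (nat \<Rightarrow> real) \<Rightarrow> complex mat" where
  "rdiag n a = mat n n (\<lambda>(i,j). if i = j then of_real (a i) else 0)"

lemma rdiag_carrier[simp]: "rdiag n a \<in> carrier_mat n n"
  by (simp add: rdiag_def)

lemma dim_rdiag[simp]: "dim_row (rdiag n a) = n" "dim_col (rdiag n a) = n"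
  by (auto simp: rdiag_def)

lemma dagger_rdiag[simp]: "dagger (rdiag n a) = rdiag n a"
  by (rule eq_matI) (auto simp: rdiag_def)

lemma index_rdiag_mult:
  assumes "X \<in> carrier_mat n m" "i < n" "j < m"
  shows "(rdiag n a * X) $$ (i,j) = of_real (a i) * X $$ (i,j)"
proof -
  have "(rdiag n a * X) $$ (i,j) = (\<Sum>k = 0..<n. (if i = k then of_real (a i) else 0) * X $$ (k,j))"
    using assms by (simp add: scalar_prod_def rdiag_def)
  then show ?thesis using assms by (simp add: if_distrib[where f = "\<lambda>x. x * _"] cong: if_cong)
qed

lemma index_mult_rdiag:
  assumes "X \<in> carrier_mat m n" "i < m" "j < n"
  shows "(X * rdiag n a) $$ (i,j) = X $$ (i,j) * of_real (a j)"
proof -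
  have "(X * rdiag n a) $$ (i,j) = (\<Sum>k = 0..<n. X $$ (i,k) * (if k = j then of_real (a k) else 0))"
    using assms by (simp add: scalar_prod_def rdiag_def)
  then show ?thesis using assms by (simp add: if_distrib[where f = "\<lambda>x. _ * x"] cong: if_cong)
qed

lemma rdiag_mult: "rdiag n a * rdiag n b = rdiag n (\<lambda>i. a i * b i)"
proof (rule eq_matI)
  fix i j assume "i < dim_row (rdiag n (\<lambda>i. a i * b i))" "j < dim_col (rdiag n (\<lambda>i. a i * b i))"
  then show "(rdiag n a * rdiag n b) $$ (i,j) = rdiag n (\<lambda>i. a i * b i) $$ (i,j)"
    by (subst index_rdiag_mult[of _ n n]) (auto simp: rdiag_def)
qed auto

lemma unitaryD:
  assumes "unitary n U"
  shows "U \<in> carrier_mat n n" "dagger U \<in> carrier_mat n n" "dagger U * U = 1\<^sub>m n" "U * dagger U = 1\<^sub>m n"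
  using assms by (auto simp: unitary_def)

lemma unitaryI:
  assumes "U \<in> carrier_mat n n" "dagger U * U = 1\<^sub>m n"
  shows "unitary n U"
  using assms mat_mult_left_right_inverse[of "dagger U" n U] by (auto simp: unitary_def)

lemma mult_carrier_square[simp]:
  "A \<in> carrier_mat n n \<Longrightarrow> B \<in> carrier_mat n n \<Longrightarrow> A * B \<in> carrier_mat n n"
  by (rule mult_carrier_mat)

lemma assoc_square:
  fixes A :: "complex mat"
  assumes "A \<in> carrier_mat n n" "B \<in> carrier_mat n n" "C \<in> carrier_mat n n"
  shows "A * B * C = A * (B * C)"
  using assms by (rule assoc_mult_mat)

text \<open>Once \<open>assoc_square\<close> has nested all products to the right, a cancelling pair
  appears in exactly this shape.\<close>

lemma mult_cancel_mid:
  fixes A :: "complex mat"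
  assumes "A \<in> carrier_mat n n" "B \<in> carrier_mat n n" "X \<in> carrier_mat n n" "A * B = 1\<^sub>m n"
  shows "A * (B * X) = X"
  using assms assoc_mult_mat[of A n n B n X n] left_mult_one_mat[of X n n] by simp

lemma unitary_mult:
  assumes "unitary n U" "unitary n V"
  shows "unitary n (U * V)"
proof (rule unitaryI)
  note U = unitaryD[OF assms(1)] and V = unitaryD[OF assms(2)]
  show "dagger (U * V) * (U * V) = 1\<^sub>m n"
    using U V mult_cancel_mid[of "dagger U" n U V]
    by (simp add: dagger_mult[of _ n n] assoc_square[of _ n])
qed (use assms in \<open>auto simp: unitary_def\<close>)

lemma hermitian_conj:
  assumes "A \<in> carrier_mat n n" "hermitian A" "U \<in> carrier_mat m n"
  shows "hermitian (U * A * dagger U)"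
proof -
  have "dagger (U * A * dagger U) = U * (dagger A * dagger U)"
    using assms dagger_mult[of "U * A" m n "dagger U" m] dagger_mult[of U m n A n] by simp
  also have "\<dots> = U * A * dagger U"
    using assms assoc_mult_mat[of U m n A n "dagger U" m] by (simp add: hermitian_def)
  finally show ?thesis using assms by (simp add: hermitian_def)
qed

text \<open>Complete \<open>v\<close> to a basis and orthogonalise it. Gram-Schmidt keeps the first
  vector, and scaling all vectors to length one gives the columns of \<open>W\<close>.\<close>

lemma unitary_first_column:
  fixes v :: "complex vec"
  assumes v: "v \<in> carrier_vec n" "v \<noteq> 0\<^sub>v n"
  shows "\<exists>W c. unitary n W \<and> c \<noteq> 0 \<and> col W 0 = c \<cdot>\<^sub>v v"
proof -
  have n: "n \<noteq> 0" using v by (metis carrier_vecD eq_vecI index_zero_vec(2) not_less_zero)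
  define b where "b = basis_completion v"
  define ws where "ws = gram_schmidt n b"
  interpret cof_vec_space n "TYPE(complex)" .
  from basis_completion[OF v, folded b_def]
  have dist_b: "distinct b" and indep: "\<not> lin_dep (set b)" and b: "set b \<subseteq> carrier_vec n" 
    and hdb: "hd b = v" and len_b: "length b = n" by auto
  from hdb len_b n obtain vs where bv: "b = v # vs" by (cases b, auto)
  from gram_schmidt_result[OF b dist_b indep refl, folded ws_def]
  have ws: "set ws \<subseteq> carrier_vec n" "corthogonal ws" "length ws = n" 
    by (auto simp: len_b)
  from gram_schmidt_hd[OF v(1), of vs, folded bv] have "hd ws = v" unfolding ws_def .
  then have ws0: "ws ! 0 = v" using ws n by (metis hd_conv_nth length_0_conv)
  have wsc: "ws ! i \<in> carrier_vec n" if "i < n" for i using ws that by auto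
  define c where "c i = 1 / sqrt (Re (ws ! i \<bullet>c ws ! i))" for i
  have pos: "Re (ws ! i \<bullet>c ws ! i) > 0 \<and> Im (ws ! i \<bullet>c ws ! i) = 0" if "i < n" for i
  proof -
    have "ws ! i \<bullet>c ws ! i \<noteq> 0" using corthogonalD[OF ws(2), of i i] that ws by auto
    moreover have "ws ! i \<bullet>c ws ! i \<ge> 0" by (rule conjugate_square_ge_0_vec)
    ultimately show ?thesis by (auto simp: less_eq_complex_def complex_eq_iff)
  qed
  define W where "W = mat n n (\<lambda>(r,j). of_real (c j) * ws ! j $ r)"
  have W: "W \<in> carrier_mat n n" by (simp add: W_def)
  have "dagger W * W = 1\<^sub>m n"
  proof (rule eq_matI)
    fix i j assume "i < dim_row (1\<^sub>m n :: complex mat)" "j < dim_col (1\<^sub>m n :: complex mat)"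
    then have ij: "i < n" "j < n" by auto
    have "(dagger W * W) $$ (i,j) = (\<Sum>r=0..<n. of_real (c i) * of_real (c j) * (ws ! j $ r * cnj (ws ! i $ r)))"
      using ij W by (auto simp: scalar_prod_def W_def intro!: sum.cong)
    also have "\<dots> = of_real (c i) * of_real (c j) * (ws ! j \<bullet>c ws ! i)"
      using wsc[OF ij(1)] wsc[OF ij(2)] by (auto simp: scalar_prod_def sum_distrib_left)
    also have "\<dots> = 1\<^sub>m n $$ (i,j)"
    proof (cases "i = j")
      case False
      then show ?thesis using corthogonalD[OF ws(2), of j i] ij ws by auto
    next
      case True
      have "ws ! i \<bullet>c ws ! i = of_real (Re (ws ! i \<bullet>c ws ! i))"
        using pos[OF ij(1)] by (auto simp: complex_eq_iff)
      moreover have "c i * c i * Re (ws ! i \<bullet>c ws ! i) = 1"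
        using pos[OF ij(1)] by (auto simp: c_def)
      ultimately have "of_real (c i) * of_real (c i) * (ws ! i \<bullet>c ws ! i) = 1"
        by (metis of_real_1 of_real_mult)
      with True ij show ?thesis by simp
    qed
    finally show "(dagger W * W) $$ (i,j) = 1\<^sub>m n $$ (i,j)" .
  qed (use W in auto)
  then have "unitary n W" by (rule unitaryI[OF W])
  moreover have "col W 0 = of_real (c 0) \<cdot>\<^sub>v v"
    by (rule eq_vecI) (use n v ws0 in \<open>auto simp: W_def\<close>)
  moreover have "of_real (c 0) \<noteq> (0::complex)" using pos[of 0] n by (auto simp: c_def)
  ultimately show ?thesis by blast
qed

text \<open>Induction on the dimension. A unitary whose first column is an eigenvector turns
  \<open>A\<close> into a matrix with the eigenvalue in the corner and zeros in the rest of the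
  first row and column; the remaining block is Hermitian and is diagonalised by the induction
  hypothesis.\<close>

theorem hermitian_spectral:
  assumes "A \<in> carrier_mat n n" "hermitian A"
  shows "\<exists>U a. unitary n U \<and> A = U * rdiag n a * dagger U"
  using assms
proof (induction n arbitrary: A)
  case 0
  then show ?case
    by (intro exI[of _ "1\<^sub>m 0"] exI[of _ "\<lambda>_. 0"]) (auto simp: unitary_def intro!: eq_matI)
next
  case (Suc n)
  note A = Suc.prems(1)
  have dA: "dagger A = A" using Suc.prems by (auto simp: hermitian_def)
  obtain e where "eigenvalue A e" using spectrum_non_empty[OF A] by (auto simp: spectrum_def)
  then obtain v where v: "v \<in> carrier_vec (Suc n)" "v \<noteq> 0\<^sub>v (Suc n)" and ev: "A *\<^sub>v v = e \<cdot>\<^sub>v v"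
    using A by (auto simp: eigenvalue_def eigenvector_def)
  obtain W c where uW: "unitary (Suc n) W" and c: "c \<noteq> 0" "col W 0 = c \<cdot>\<^sub>v v"
    using unitary_first_column[OF v] by blast
  note W = unitaryD[OF uW]
  define A' where "A' = dagger W * A * W"
  have A': "A' \<in> carrier_mat (Suc n) (Suc n)" using A W by (auto simp: A'_def)
  have "hermitian A'" using hermitian_conj[OF A Suc.prems(2), of "dagger W" "Suc n"] W by (auto simp: A'_def)
  then have hA': "dagger A' = A'" by (simp add: hermitian_def)
  have first: "A' $$ (i,0) = (if i = 0 then e else 0)" if i: "i < Suc n" for i
  proof -
    have "col A' 0 = (dagger W * A) *\<^sub>v col W 0"
      unfolding A'_def by (rule col_mult2[OF mult_carrier_mat[OF W(2) A] W(1)]) simp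
    also have "\<dots> = dagger W *\<^sub>v (A *\<^sub>v (c \<cdot>\<^sub>v v))"
      unfolding c(2) by (rule assoc_mult_mat_vec[OF W(2) A]) (use v in simp)
    also have "A *\<^sub>v (c \<cdot>\<^sub>v v) = e \<cdot>\<^sub>v col W 0"
      using A v c ev by (simp add: mult_mat_vec[of A "Suc n" "Suc n"] smult_smult_assoc mult.commute)
    also have "dagger W *\<^sub>v (e \<cdot>\<^sub>v col W 0) = e \<cdot>\<^sub>v (dagger W *\<^sub>v col W 0)"
      using c v by (intro mult_mat_vec[OF W(2)]) simp
    also have "dagger W *\<^sub>v col W 0 = col (dagger W * W) 0"
      by (rule col_mult2[symmetric, OF W(2,1)]) simp
    also have "\<dots> = col (1\<^sub>m (Suc n)) 0" by (simp only: W(3))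
    finally have "col A' 0 $ i = (e \<cdot>\<^sub>v col (1\<^sub>m (Suc n)) 0) $ i" by simp
    then show ?thesis using i A' by auto
  qed
  \<comment> \<open>Hermiticity carries the zeros of the first column over to the first row and
    makes \<open>e\<close> real.\<close>
  have first': "A' $$ (0,j) = (if j = 0 then e else 0)" if j: "j < Suc n" for j
  proof -
    have "A' $$ (0,j) = cnj (A' $$ (j,0))"
      using arg_cong[OF hA', of "\<lambda>M. M $$ (0,j)"] j A' by auto
    moreover have "e = cnj e"
      using arg_cong[OF hA', of "\<lambda>M. M $$ (0,0)"] first[of 0] A' by auto
    ultimately show ?thesis using first[OF j] by (simp split: if_splits)
  qed
  have re: "e = of_real (Re e)"
    using arg_cong[OF hA', of "\<lambda>M. M $$ (0,0)"] first[of 0] A' by (auto simp: complex_eq_iff)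
  define A3 where "A3 = mat n n (\<lambda>(i,j). A' $$ (Suc i, Suc j))"
  have A3: "A3 \<in> carrier_mat n n" by (simp add: A3_def)
  have "dagger A3 = A3"
  proof (rule eq_matI)
    fix i j assume "i < dim_row A3" "j < dim_col A3"
    then have ij: "i < n" "j < n" by (auto simp: A3_def)
    then show "dagger A3 $$ (i,j) = A3 $$ (i,j)"
      using arg_cong[OF hA', of "\<lambda>M. M $$ (Suc i, Suc j)"] A' by (auto simp: A3_def)
  qed (use A3 in auto)
  then have "hermitian A3" using A3 by (auto simp: hermitian_def)
  then obtain U a where uU: "unitary n U" and A3eq: "A3 = U * rdiag n a * dagger U"
    using Suc.IH[OF A3] by blast
  note U = unitaryD[OF uU]
  let ?I = "1\<^sub>m 1 :: complex mat" let ?r = "0\<^sub>m 1 n :: complex mat" let ?c = "0\<^sub>m n 1 :: complex mat"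
  \<comment> \<open>The diagonaliser of the small block, extended by 1 in the corner so that it
    fixes the eigenvector already split off.\<close>
  define V where "V = four_block_mat ?I ?r ?c U"
  have V: "V \<in> carrier_mat (Suc n) (Suc n)" using U by (auto simp: V_def)
  have dV: "dagger V = four_block_mat ?I ?r ?c (dagger U)"
    by (rule eq_matI) (use U in \<open>auto simp: V_def\<close>)
  have "dagger V * V = four_block_mat ?I ?r ?c (1\<^sub>m n)"
    unfolding dV unfolding V_def by (subst mult_four_block_mat[of _ 1 1 _ n _ n]) (use U in auto)
  also have "\<dots> = 1\<^sub>m (Suc n)" by (rule eq_matI) auto
  finally have uV: "unitary (Suc n) V" by (rule unitaryI[OF V])
  define b where "b i = (case i of 0 \<Rightarrow> Re e | Suc k \<Rightarrow> a k)" for i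
  have rb: "rdiag (Suc n) b = four_block_mat (rdiag 1 (\<lambda>_. Re e)) ?r ?c (rdiag n a)"
    by (rule eq_matI) (auto simp: rdiag_def b_def split: nat.splits)
  have "V * rdiag (Suc n) b * dagger V = four_block_mat (rdiag 1 (\<lambda>_. Re e)) ?r ?c (U * rdiag n a * dagger U)"
    unfolding dV rb unfolding V_def
    by (subst mult_four_block_mat[of _ 1 1 _ n _ n], (use U in auto)[8],
        subst mult_four_block_mat[of _ 1 1 _ n _ n]) (use U in auto)
  also have "\<dots> = A'"
  proof (rule eq_matI)
    fix i j assume "i < dim_row A'" "j < dim_col A'"
    then have ij: "i < Suc n" "j < Suc n" using A' by auto
    then show "four_block_mat (rdiag 1 (\<lambda>_. Re e)) ?r ?c (U * rdiag n a * dagger U) $$ (i,j) = A' $$ (i,j)"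
      unfolding A3eq[symmetric] using first[of i] first'[of j] re
      by (cases i; cases j) (auto simp: rdiag_def A3_def)
  qed (use A' U in auto)
  finally have A'eq: "A' = V * rdiag (Suc n) b * dagger V" ..
  have "A = W * A' * dagger W"
    unfolding A'_def using W A
    by (simp add: assoc_square[of _ "Suc n"] mult_cancel_mid[of W "Suc n"])
  also have "\<dots> = (W * V) * rdiag (Suc n) b * dagger (W * V)"
    unfolding A'eq using W V
    by (simp add: dagger_mult[of _ "Suc n" "Suc n"] assoc_square[of _ "Suc n"])
  finally show ?case using unitary_mult[OF uW uV] by blast
qed

subsection \<open>Positive semidefinite matrices and their square roots\<close>

lemma unitary_cancel:
  assumes "unitary n U" "X \<in> carrier_mat n n"
  shows "U * (dagger U * X) = X" "dagger U * (U * X) = X"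
  using unitaryD[OF assms(1)] assms(2) mult_cancel_mid[of U n "dagger U" X] mult_cancel_mid[of "dagger U" n U X]
  by auto

lemma quadratic_form_eq:
  assumes "A \<in> carrier_mat n n" "v \<in> carrier_vec n"
  shows "conjugate v \<bullet> (A *\<^sub>v v) = (\<Sum>i<n. \<Sum>j<n. cnj (v $ i) * A $$ (i,j) * v $ j)"
  using assms
  by (auto simp: scalar_prod_def lessThan_atLeast0 sum_distrib_left mult.assoc intro!: sum.cong)

lemma psdD:
  assumes "psd n A"
  shows "A \<in> carrier_mat n n" "hermitian A" "dagger A = A"
  using assms by (auto simp: psd_def hermitian_def)

lemma psd_gram:
  assumes "B \<in> carrier_mat n m"
  shows "psd n (B * dagger B)"
  unfolding psd_def
proof (intro conjI ballI)
  show "B * dagger B \<in> carrier_mat n n" using assms by simp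
  show "hermitian (B * dagger B)"
    using assms dagger_mult[of B n m "dagger B" n] by (simp add: hermitian_def)
  fix v :: "complex vec" assume v: "v \<in> carrier_vec n"
  \<comment> \<open>The row vector got by multiplying \<open>B\<close> on the left with the adjoint
    of \<open>v\<close>; the quadratic form is its squared length.\<close>
  define w where "w k = (\<Sum>i<n. cnj (v $ i) * B $$ (i,k))" for k
  have cw: "cnj (w k) = (\<Sum>j<n. cnj (B $$ (j,k)) * v $ j)" for k
    by (simp add: w_def mult.commute)
  have "conjugate v \<bullet> ((B * dagger B) *\<^sub>v v)
      = (\<Sum>i<n. \<Sum>j<n. \<Sum>k<m. cnj (v $ i) * B $$ (i,k) * (cnj (B $$ (j,k)) * v $ j))"
    using assms v by (subst quadratic_form_eq[of _ n])
      (auto simp: scalar_prod_def lessThan_atLeast0 sum_distrib_left sum_distrib_right mult.assoc intro!: sum.cong)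
  also have "\<dots> = (\<Sum>i<n. \<Sum>k<m. \<Sum>j<n. cnj (v $ i) * B $$ (i,k) * (cnj (B $$ (j,k)) * v $ j))"
    by (intro sum.cong[OF refl] sum.swap)
  also have "\<dots> = (\<Sum>k<m. \<Sum>i<n. \<Sum>j<n. cnj (v $ i) * B $$ (i,k) * (cnj (B $$ (j,k)) * v $ j))"
    by (rule sum.swap)
  also have "\<dots> = (\<Sum>k<m. w k * cnj (w k))"
    unfolding cw unfolding w_def by (simp add: sum_product)
  also have "\<dots> = of_real (\<Sum>k<m. (cmod (w k))\<^sup>2)"
    by (simp only: of_real_sum complex_norm_square)
  finally show "0 \<le> Re (conjugate v \<bullet> ((B * dagger B) *\<^sub>v v))"
    by (simp add: sum_nonneg del: of_real_sum)
qed

lemma psd_spectral: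
  assumes "psd n A"
  shows "\<exists>U a. unitary n U \<and> (\<forall>i. a i \<ge> 0) \<and> A = U * rdiag n a * dagger U"
proof -
  note A = psdD[OF assms]
  obtain U a where uU: "unitary n U" and eq: "A = U * rdiag n a * dagger U"
    using hermitian_spectral[OF A(1,2)] by blast
  note U = unitaryD[OF uU]
  have nn: "a i \<ge> 0" if i: "i < n" for i
  proof -
    \<comment> \<open>Solving for the diagonal exhibits each eigenvalue as the quadratic form of
      \<open>A\<close> at a column of \<open>U\<close>.\<close>
    have "dagger U * (A * U) = rdiag n a"
      unfolding eq using U by (simp add: assoc_square[of _ n] unitary_cancel[OF uU])
    then have "of_real (a i) = (dagger U * (A * U)) $$ (i,i)" using i by (simp add: rdiag_def)
    also have "\<dots> = row (dagger U) i \<bullet> col (A * U) i"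
      using U A i by simp
    also have "col (A * U) i = A *\<^sub>v col U i"
      by (rule col_mult2[OF A(1) U(1) i])
    also have "row (dagger U) i = conjugate (col U i)"
      by (rule eq_vecI) (use U i in auto)
    finally have "of_real (a i) = conjugate (col U i) \<bullet> (A *\<^sub>v col U i)" .
    then have "a i = Re (conjugate (col U i) \<bullet> (A *\<^sub>v col U i))" by (metis Re_complex_of_real)
    moreover have "col U i \<in> carrier_vec n" using U by auto
    ultimately show ?thesis using assms by (simp add: psd_def)
  qed
  \<comment> \<open>Values of \<open>a\<close> from \<open>n\<close> on do not reach the matrix;
    setting them to zero makes nonnegativity hold at every index.\<close>
  have "rdiag n a = rdiag n (\<lambda>i. if i < n then a i else 0)"
    by (rule eq_matI) (auto simp: rdiag_def)
  with uU eq nn show ?thesis by (intro exI[of _ U] exI[of _ "\<lambda>i. if i < n then a i else 0"]) auto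
qed

lemma unitary_rdiag_mult:
  assumes "unitary n U"
  shows "(U * rdiag n a * dagger U) * (U * rdiag n b * dagger U) = U * rdiag n (\<lambda>i. a i * b i) * dagger U"
proof -
  note U = unitaryD[OF assms]
  have "(U * rdiag n a * dagger U) * (U * rdiag n b * dagger U) = U * (rdiag n a * rdiag n b) * dagger U"
    using U by (simp add: assoc_square[of _ n] unitary_cancel[OF assms])
  then show ?thesis by (simp add: rdiag_mult)
qed

lemma psd_unitary_rdiag:
  assumes "unitary n U" "\<And>i. a i \<ge> 0"
  shows "psd n (U * rdiag n a * dagger U)"
proof -
  note U = unitaryD[OF assms(1)]
  have "(U * rdiag n (\<lambda>i. sqrt (a i))) * dagger (U * rdiag n (\<lambda>i. sqrt (a i)))
      = U * (rdiag n (\<lambda>i. sqrt (a i)) * rdiag n (\<lambda>i. sqrt (a i))) * dagger U"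
    using U by (simp add: assoc_square[of _ n] dagger_mult[of U n n _ n])
  also have "\<dots> = U * rdiag n a * dagger U"
    by (simp add: rdiag_mult assms(2))
  finally show ?thesis using psd_gram[of "U * rdiag n (\<lambda>i. sqrt (a i))" n n] U by simp
qed

section \<open>Existence and uniqueness of the square root\<close>

lemma psd_sqrt_exists:
  assumes "psd n A"
  shows "\<exists>B. psd n B \<and> B * B = A"
proof -
  obtain U a where U: "unitary n U" and a: "\<forall>i. a i \<ge> 0" and eq: "A = U * rdiag n a * dagger U"
    using psd_spectral[OF assms] by blast
  have "(U * rdiag n (\<lambda>i. sqrt (a i)) * dagger U) * (U * rdiag n (\<lambda>i. sqrt (a i)) * dagger U) = A"
    unfolding unitary_rdiag_mult[OF U] eq using a by simp
  then show ?thesis using psd_unitary_rdiag[OF U, of "\<lambda>i. sqrt (a i)"] a by auto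
qed

text \<open>In eigenbases of \<open>B\<close> and \<open>C\<close> the entries of \<open>X\<close> satisfy
  \<open>(b\<^sub>i\<^sup>2 - c\<^sub>j\<^sup>2) x\<^sub>i\<^sub>j = 0\<close>. With \<open>X = 1\<close> this gives uniqueness of square roots, with
  \<open>B = C\<close> that a square root commutes with whatever commutes with its square.\<close>

lemma sqrt_intertwine:
  assumes B: "psd n B" and C: "psd n C" and X: "X \<in> carrier_mat n n" and eq: "B * B * X = X * (C * C)"
  shows "B * X = X * C"
proof -
  obtain U b where uU: "unitary n U" and b: "\<forall>i. b i \<ge> 0" and Beq: "B = U * rdiag n b * dagger U"
    using psd_spectral[OF B] by blast
  obtain V c where uV: "unitary n V" and c: "\<forall>i. c i \<ge> 0" and Ceq: "C = V * rdiag n c * dagger V"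
    using psd_spectral[OF C] by blast
  note U = unitaryD[OF uU] and V = unitaryD[OF uV]
  define W where "W = dagger U * (X * V)"
  have W: "W \<in> carrier_mat n n" using U V X by (simp add: W_def)
  have "dagger U * (B * B * X) * V = dagger U * (X * (C * C)) * V" by (simp only: eq)
  then have sq: "rdiag n (\<lambda>i. b i * b i) * W = W * rdiag n (\<lambda>i. c i * c i)"
    unfolding Beq Ceq unitary_rdiag_mult[OF uU] unitary_rdiag_mult[OF uV] W_def
    using U V X by (simp add: assoc_square[of _ n] unitary_cancel[OF uU] unitary_cancel[OF uV])
  have "rdiag n b * W = W * rdiag n c"
  proof (rule eq_matI)
    fix i j assume "i < dim_row (W * rdiag n c)" "j < dim_col (W * rdiag n c)"
    then have ij: "i < n" "j < n" using W by auto
    have "(rdiag n (\<lambda>i. b i * b i) * W) $$ (i,j) = (W * rdiag n (\<lambda>i. c i * c i)) $$ (i,j)"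
      by (simp only: sq)
    then have "of_real (b i * b i - c j * c j) * W $$ (i,j) = 0"
      unfolding index_rdiag_mult[OF W ij] index_mult_rdiag[OF W ij] by (simp add: algebra_simps)
    \<comment> \<open>Nonnegative reals with equal squares are equal; positivity of both roots
      enters here.\<close>
    then have "W $$ (i,j) = 0 \<or> b i = c j"
      using b c by (auto simp: power2_eq_square[symmetric] power2_eq_iff_nonneg simp flip: of_real_power)
    then show "(rdiag n b * W) $$ (i,j) = (W * rdiag n c) $$ (i,j)"
      unfolding index_rdiag_mult[OF W ij] index_mult_rdiag[OF W ij] by auto
  qed (use W in auto)
  then have "U * (rdiag n b * W) * dagger V = U * (W * rdiag n c) * dagger V" by simp
  then show ?thesis
    unfolding Beq Ceq W_def
    using U V X by (simp add: assoc_square[of _ n] unitary_cancel[OF uU] unitary_cancel[OF uV])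
qed

lemma psd_sqrt_unique:
  assumes "psd n B" "psd n C" "B * B = C * C"
  shows "B = C"
  using sqrt_intertwine[OF assms(1,2), of "1\<^sub>m n"] psdD(1)[OF assms(1)] psdD(1)[OF assms(2)] assms(3)
  by simp

lemma msqrt_eqI:
  assumes "psd n B" "B * B = A"
  shows "msqrt n A = B"
  unfolding msqrt_def using assms by (intro the_equality) (auto intro: psd_sqrt_unique)

lemma msqrt:
  assumes "psd n A"
  shows "psd n (msqrt n A)" "msqrt n A * msqrt n A = A"
  using psd_sqrt_exists[OF assms] msqrt_eqI by metis+

lemma msqrt_carrier: "psd n A \<Longrightarrow> msqrt n A \<in> carrier_mat n n"
  by (rule psdD(1)[OF msqrt(1)])

lemma msqrt_dagger: "psd n A \<Longrightarrow> dagger (msqrt n A) = msqrt n A"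
  by (rule psdD(3)[OF msqrt(1)])

text \<open>The root is Hermitian, so \<open>A\<close> is the root times its own adjoint. Hence the
  trace is real and nonnegative, and zero only if the root vanishes.\<close>

lemma mtrace_psd: "psd n A \<Longrightarrow> mtrace A = of_real (hs2 (msqrt n A))"
  using mtrace_self_dagger[of "msqrt n A"] by (simp add: msqrt msqrt_dagger)

lemma Re_mtrace_psd: "psd n A \<Longrightarrow> Re (mtrace A) = hs2 (msqrt n A)"
  by (simp add: mtrace_psd)

lemma psd_trace_0:
  assumes "psd n A" "Re (mtrace A) = 0"
  shows "A = 0\<^sub>m n n"
proof -
  have "msqrt n A = 0\<^sub>m n n"
    using assms hs2_eq_0[OF msqrt_carrier] by (simp add: Re_mtrace_psd)
  then show ?thesis using msqrt(2)[OF assms(1)] by simp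
qed

text \<open>Splitting \<open>A\<close> into two roots exhibits the conjugate as the Gram matrix of
  \<open>K * msqrt n A\<close>.\<close>

lemma psd_conj:
  assumes "psd n A" "K \<in> carrier_mat n n"
  shows "psd n (K * A * dagger K)"
proof -
  note S = msqrt_carrier[OF assms(1)]
  have "K * msqrt n A * dagger (K * msqrt n A) = K * (msqrt n A * msqrt n A) * dagger K"
    using assms(2) S by (simp add: dagger_mult[of K n n _ n] assoc_square[of _ n] msqrt_dagger[OF assms(1)])
  then have "K * A * dagger K = (K * msqrt n A) * dagger (K * msqrt n A)"
    by (simp add: msqrt(2)[OF assms(1)])
  then show ?thesis using psd_gram[of "K * msqrt n A" n n] assms(2) S by simp
qed

lemma psd_smult:
  assumes "psd n A" "c \<ge> 0"
  shows "psd n (of_real c \<cdot>\<^sub>m A)"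
proof -
  note A = psdD[OF assms(1)]
  have "hermitian (of_real c \<cdot>\<^sub>m A)" using A by (simp add: hermitian_def dagger_smult)
  moreover have "0 \<le> Re (conjugate v \<bullet> ((of_real c \<cdot>\<^sub>m A) *\<^sub>v v))" if v: "v \<in> carrier_vec n" for v
  proof -
    have "conjugate v \<bullet> ((of_real c \<cdot>\<^sub>m A) *\<^sub>v v) = of_real c * (conjugate v \<bullet> (A *\<^sub>v v))"
      using A v by (simp add: quadratic_form_eq[of _ n] sum_distrib_left mult_ac)
    then show ?thesis using assms v by (simp add: psd_def)
  qed
  ultimately show ?thesis using A by (simp add: psd_def)
qed

lemma psd_mat_sum:
  assumes F: "\<And>k. k \<in> I \<Longrightarrow> psd n (F k)"
  shows "psd n (mat_sum n I F)"
proof -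
  have "hermitian (mat_sum n I F)"
    using F psdD[OF F] by (simp add: hermitian_def dagger_mat_sum cong: mat_sum_cong) (simp add: mat_sum_def)
  moreover have "0 \<le> Re (conjugate v \<bullet> (mat_sum n I F *\<^sub>v v))" if v: "v \<in> carrier_vec n" for v
  proof -
    have "conjugate v \<bullet> (mat_sum n I F *\<^sub>v v) = (\<Sum>i<n. \<Sum>j<n. \<Sum>k\<in>I. cnj (v $ i) * F k $$ (i,j) * v $ j)"
      using v by (simp add: quadratic_form_eq[of _ n] sum_distrib_left sum_distrib_right)
    also have "\<dots> = (\<Sum>i<n. \<Sum>k\<in>I. \<Sum>j<n. cnj (v $ i) * F k $$ (i,j) * v $ j)"
      by (intro sum.cong[OF refl] sum.swap)
    also have "\<dots> = (\<Sum>k\<in>I. \<Sum>i<n. \<Sum>j<n. cnj (v $ i) * F k $$ (i,j) * v $ j)"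
      by (rule sum.swap)
    also have "\<dots> = (\<Sum>k\<in>I. conjugate v \<bullet> (F k *\<^sub>v v))"
      using v psdD(1)[OF F] by (intro sum.cong refl) (simp add: quadratic_form_eq[of _ n])
    finally show ?thesis using F v by (simp add: psd_def sum_nonneg)
  qed
  ultimately show ?thesis by (simp add: psd_def)
qed

lemma smult_smult_mat: "a \<cdot>\<^sub>m (b \<cdot>\<^sub>m A) = (a * b) \<cdot>\<^sub>m (A :: complex mat)"
  by (rule eq_matI) auto

lemma msqrt_smult:
  assumes "psd n A" "c \<ge> 0"
  shows "msqrt n (of_real c \<cdot>\<^sub>m A) = of_real (sqrt c) \<cdot>\<^sub>m msqrt n A"
proof (rule msqrt_eqI)
  note S = msqrt_carrier[OF assms(1)]
  show "psd n (of_real (sqrt c) \<cdot>\<^sub>m msqrt n A)"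
    using assms msqrt by (intro psd_smult) auto
  have "of_real (sqrt c) \<cdot>\<^sub>m msqrt n A * (of_real (sqrt c) \<cdot>\<^sub>m msqrt n A)
      = (of_real (sqrt c) * of_real (sqrt c)) \<cdot>\<^sub>m (msqrt n A * msqrt n A)"
    using S by (simp add: mult_smult_distrib[of _ n n _ n] smult_smult_mat mult_smult_assoc_mat[of _ n n _ n])
  also have "\<dots> = of_real c \<cdot>\<^sub>m A"
    using assms by (simp add: msqrt flip: of_real_mult)
  finally show "of_real (sqrt c) \<cdot>\<^sub>m msqrt n A * (of_real (sqrt c) \<cdot>\<^sub>m msqrt n A) = of_real c \<cdot>\<^sub>m A" .
qed

lemma affinity_self_adjoint:
  assumes "psd n A" "psd n B"
  shows "affinity n A B = Re (mtrace (msqrt n A * dagger (msqrt n B)))"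
  using assms by (simp add: affinity_def msqrt_dagger)

lemma affinity_smult:
  assumes "psd n A" "psd n B" "c \<ge> 0" "d \<ge> 0"
  shows "affinity n (of_real c \<cdot>\<^sub>m A) (of_real d \<cdot>\<^sub>m B) = sqrt c * sqrt d * affinity n A B"
proof -
  note S = msqrt_carrier[OF assms(1)] msqrt_carrier[OF assms(2)]
  have "of_real (sqrt c) \<cdot>\<^sub>m msqrt n A * (of_real (sqrt d) \<cdot>\<^sub>m msqrt n B)
      = of_real (sqrt c * sqrt d) \<cdot>\<^sub>m (msqrt n A * msqrt n B)"
    using S by (simp add: mult_smult_distrib[of _ n n _ n] smult_smult_mat mult_smult_assoc_mat[of _ n n _ n] mult.commute)
  then show ?thesis
    using assms S mtrace_smult[of "msqrt n A * msqrt n B" n "of_real (sqrt c * sqrt d)"]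
    by (simp add: affinity_def msqrt_smult)
qed

subsection \<open>A variational formula for the affinity\<close>

text \<open>\<open>A\<close> acts from the left on \<open>Z\<close> and \<open>B\<close> from the
  right on \<open>1\<^sub>m n - Z\<close>. In eigenbases the row index then carries the eigenvalues
  of \<open>A\<close> and the column index those of \<open>B\<close>, so the entries decouple even
  when \<open>A\<close> and \<open>B\<close> do not commute.\<close>

definition pform :: "nat \<Rightarrow> real \<Rightarrow> complex mat \<Rightarrow> complex mat \<Rightarrow> complex mat \<Rightarrow> real" where
  "pform n u A B Z = Re (mtrace (dagger Z * A * Z)) + u\<^sup>2 * Re (mtrace ((1\<^sub>m n - Z) * B * dagger (1\<^sub>m n - Z)))"

lemma mtrace_mult_rdiag:
  assumes "Y \<in> carrier_mat n n"
  shows "Re (mtrace (Y * rdiag n d * dagger Y)) = (\<Sum>i<n. \<Sum>j<n. d j * (cmod (Y $$ (i,j)))\<^sup>2)"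
proof -
  have "Y $$ (i,j) * of_real (d j) * cnj (Y $$ (i,j)) = of_real (d j * (cmod (Y $$ (i,j)))\<^sup>2)" for i j
    by (simp only: of_real_mult complex_norm_square mult_ac)
  then have "mtrace (Y * rdiag n d * dagger Y) = of_real (\<Sum>i<n. \<Sum>j<n. d j * (cmod (Y $$ (i,j)))\<^sup>2)"
    using assms by (simp add: mtrace_mult_dagger[of _ n n] index_mult_rdiag[of _ n n] del: of_real_mult of_real_power index_mult_mat(1))
  then show ?thesis by simp
qed

lemma mtrace_rdiag_mult:
  assumes "Y \<in> carrier_mat n n"
  shows "Re (mtrace (dagger Y * rdiag n d * Y)) = (\<Sum>i<n. \<Sum>j<n. d i * (cmod (Y $$ (i,j)))\<^sup>2)"
  using mtrace_mult_rdiag[of "dagger Y" n d] assms by (subst sum.swap) simp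

lemma mtrace_unitary_conj:
  assumes "unitary n U" "X \<in> carrier_mat n n"
  shows "mtrace (dagger U * X * U) = mtrace X"
  using assms unitaryD[OF assms(1)] mtrace_mult_comm[of "dagger U * X" n n U]
  by (simp add: unitary_cancel[OF assms(1)])

text \<open>The coefficient is the parallel sum of \<open>s\<close> and \<open>t\<close>: the least
  cost of splitting \<open>e\<close> into \<open>y\<close> and \<open>e - y\<close>. With
  \<open>a\<close> and \<open>b\<close> the moduli of the parts, the triangle inequality bounds
  \<open>cmod e\<close> by \<open>a + b\<close>, and \<open>s * t * (a + b)\<^sup>2\<close> falls
  short of \<open>(s + t) * (s * a\<^sup>2 + t * b\<^sup>2)\<close> by the square of
  \<open>s * a - t * b\<close>.\<close>

lemma parallel_le:
  fixes s t :: real and y e :: complex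
  assumes "s \<ge> 0" "t \<ge> 0"
  shows "s * t / (s + t) * (cmod e)\<^sup>2 \<le> s * (cmod y)\<^sup>2 + t * (cmod (e - y))\<^sup>2"
proof (cases "s + t = 0")
  case False
  then have pos: "s + t > 0" using assms by simp
  define a b where "a = cmod y" and "b = cmod (e - y)"
  have "cmod e \<le> a + b" unfolding a_def b_def using norm_triangle_ineq[of y "e - y"] by simp
  then have "(cmod e)\<^sup>2 \<le> (a + b)\<^sup>2" by (intro power_mono) auto
  then have "s * t * (cmod e)\<^sup>2 \<le> s * t * (a + b)\<^sup>2" using assms by (intro mult_left_mono) auto
  also have "\<dots> = (s + t) * (s * a\<^sup>2 + t * b\<^sup>2) - (s * a - t * b)\<^sup>2"
    by (simp add: power2_eq_square algebra_simps)
  also have "\<dots> \<le> (s * a\<^sup>2 + t * b\<^sup>2) * (s + t)" by (simp add: mult.commute)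
  finally show ?thesis unfolding a_def b_def using pos by (simp add: pos_divide_le_eq)
qed (use assms in simp)

text \<open>The minimiser balances the two costs, \<open>s * y = t * (e - y)\<close>. If
  \<open>s\<close> and \<open>t\<close> are both zero, both sides vanish.\<close>

lemma parallel_eq:
  fixes s t :: real and e :: complex
  assumes "s \<ge> 0" "t \<ge> 0"
  defines "y \<equiv> of_real (t / (s + t)) * e"
  shows "s * t / (s + t) * (cmod e)\<^sup>2 = s * (cmod y)\<^sup>2 + t * (cmod (e - y))\<^sup>2"
proof (cases "s + t = 0")
  case False
  have "1 - t / (s + t) = s / (s + t)" using False by (simp add: field_simps)
  then have "e - y = of_real (s / (s + t)) * e"
    unfolding y_def by (metis left_diff_distrib mult_1 of_real_1 of_real_diff)
  then have "s * (cmod y)\<^sup>2 + t * (cmod (e - y))\<^sup>2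
      = (s * (t / (s + t))\<^sup>2 + t * (s / (s + t))\<^sup>2) * (cmod e)\<^sup>2"
    using assms by (simp add: y_def norm_mult power_mult_distrib distrib_right power_divide
        del: of_real_divide of_real_add)
  also have "s * (t / (s + t))\<^sup>2 + t * (s / (s + t))\<^sup>2 = s * t / (s + t)"
  proof -
    have "s * (t / x)\<^sup>2 + t * (s / x)\<^sup>2 = (s * t * (s + t)) / (x * x)" for x
      by (simp add: power2_eq_square distrib_left add_divide_distrib mult_ac)
    from this[of "s + t"] show ?thesis using False by simp
  qed
  finally show ?thesis ..
qed (use assms in auto)

text \<open>The primitive in \<open>u\<close> of the scalar integrand, with \<open>p\<close> and
  \<open>q\<close> the square roots of the eigenvalues. For \<open>p = 0\<close> the factor
  \<open>p\<close> makes the function and its derivative zero, whatever value \<open>q / p\<close>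
  has.\<close>

lemma arctan_scaled_deriv:
  fixes p q :: real
  assumes "p \<ge> 0" "q \<ge> 0"
  shows "((\<lambda>u. p * q * arctan (u * (q / p))) has_real_derivative (p\<^sup>2 * q\<^sup>2 / (p\<^sup>2 + u\<^sup>2 * q\<^sup>2))) (at u)"
proof (cases "p = 0")
  case False
  have nz: "p\<^sup>2 + u\<^sup>2 * q\<^sup>2 \<noteq> 0" using False by (simp add: add_nonneg_eq_0_iff)
  have "((\<lambda>u. p * q * arctan (u * (q / p))) has_real_derivative
      (p * q * ((q / p) / (1 + (u * (q / p))\<^sup>2)))) (at u)"
    by (auto intro!: derivative_eq_intros simp: divide_simps)
  also have "p * q * ((q / p) / (1 + (u * (q / p))\<^sup>2)) = q\<^sup>2 / (1 + (u * (q / p))\<^sup>2)"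
    using False by (simp add: power2_eq_square)
  also have "1 + (u * (q / p))\<^sup>2 = (p\<^sup>2 + u\<^sup>2 * q\<^sup>2) / p\<^sup>2"
    using False by (simp add: field_simps power_mult_distrib)
  also have "q\<^sup>2 / ((p\<^sup>2 + u\<^sup>2 * q\<^sup>2) / p\<^sup>2) = p\<^sup>2 * q\<^sup>2 / (p\<^sup>2 + u\<^sup>2 * q\<^sup>2)"
    by simp
  finally show ?thesis .
qed simp

lemma arctan_scaled_limit:
  fixes p q :: real
  assumes "p \<ge> 0" "q \<ge> 0"
  shows "((\<lambda>u. p * q * arctan (u * (q / p))) \<longlongrightarrow> p * q * (pi / 2)) at_top"
proof (cases "p = 0 \<or> q = 0")
  case False
  then have "q / p > 0" using assms by simp
  then have "filterlim (\<lambda>u. u * (q / p)) at_top at_top"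
    using filterlim_at_top_mult_tendsto_pos[OF tendsto_const _ filterlim_ident, of "q / p"] by simp
  then have "((\<lambda>u. arctan (u * (q / p))) \<longlongrightarrow> pi / 2) at_top"
    by (rule filterlim_compose[OF tendsto_arctan_at_top])
  then show ?thesis by (intro tendsto_intros)
qed auto

text \<open>States without integrals that \<open>J\<close> integrates over the positive half-line to
  \<open>pi / 2\<close> times the affinity: \<open>F\<close> is a primitive starting at 0 with the
  right limit. The last two clauses make \<open>u\<^sup>2 * J u\<close> the attained minimum of
  \<open>pform\<close>; the factor \<open>u\<^sup>2\<close> clears a denominator, so
  \<open>u = 0\<close> is no exception.\<close>

definition affinity_primitive ::
  "nat \<Rightarrow> complex mat \<Rightarrow> complex mat \<Rightarrow> (real \<Rightarrow> real) \<Rightarrow> (real \<Rightarrow> real) \<Rightarrow> bool" where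
  "affinity_primitive n A B F J \<longleftrightarrow>
     F 0 = 0 \<and> (\<forall>u. (F has_real_derivative J u) (at u))
     \<and> (F \<longlongrightarrow> affinity n A B * (pi / 2)) at_top
     \<and> (\<forall>u. \<forall>Z\<in>carrier_mat n n. u\<^sup>2 * J u \<le> pform n u A B Z)
     \<and> (\<forall>u. \<exists>Z\<in>carrier_mat n n. u\<^sup>2 * J u = pform n u A B Z)"

text \<open>\<open>\<integral>\<^sub>0\<^sup>\<infinity> st / (s + u\<^sup>2 t) du = (\<pi>/2) \<surd>(st)\<close>, applied to the eigenvalues \<open>s\<close> of \<open>A\<close> and
  \<open>t\<close> of \<open>B\<close>; the integrand is the minimum over \<open>z\<close> of \<open>s|z|\<^sup>2/u\<^sup>2 + t|1 - z|\<^sup>2\<close>.\<close>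

lemma affinity_primitive_exists:
  assumes "psd n A" "psd n B"
  shows "\<exists>F J. affinity_primitive n A B F J"
proof -
  obtain U p where uU: "unitary n U" and p: "\<forall>i. p i \<ge> 0" and P: "msqrt n A = U * rdiag n p * dagger U"
    using psd_spectral[OF msqrt(1)[OF assms(1)]] by blast
  obtain V q where uV: "unitary n V" and q: "\<forall>i. q i \<ge> 0" and Q: "msqrt n B = V * rdiag n q * dagger V"
    using psd_spectral[OF msqrt(1)[OF assms(2)]] by blast
  note U = unitaryD[OF uU] and V = unitaryD[OF uV]
  note cancel = unitary_cancel[OF uU] unitary_cancel[OF uV]
  have A: "A = U * rdiag n (\<lambda>i. (p i)\<^sup>2) * dagger U"
    using msqrt(2)[OF assms(1)] unfolding P unitary_rdiag_mult[OF uU] by (simp add: power2_eq_square)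
  have B: "B = V * rdiag n (\<lambda>i. (q i)\<^sup>2) * dagger V"
    using msqrt(2)[OF assms(2)] unfolding Q unitary_rdiag_mult[OF uV] by (simp add: power2_eq_square)
  \<comment> \<open>Overlaps of the two eigenbases. Their squared moduli \<open>w\<close> are the
    weights with which the products of eigenvalue roots enter the affinity.\<close>
  define E where "E = dagger U * V"
  have E: "E \<in> carrier_mat n n" using U V by (simp add: E_def)
  define w where "w i j = (cmod (E $$ (i,j)))\<^sup>2" for i j
  define F where "F u = (\<Sum>i<n. \<Sum>j<n. p i * q j * arctan (u * (q j / p i)) * w i j)" for u
  define J where "J u = (\<Sum>i<n. \<Sum>j<n. (p i)\<^sup>2 * (q j)\<^sup>2 / ((p i)\<^sup>2 + u\<^sup>2 * (q j)\<^sup>2) * w i j)" for u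
  have aff: "affinity n A B = (\<Sum>i<n. \<Sum>j<n. p i * q j * w i j)"
  proof -
    have "mtrace (msqrt n A * msqrt n B) = mtrace (dagger U * (msqrt n A * msqrt n B) * U)"
      using mtrace_unitary_conj[OF uU] msqrt_carrier[OF assms(1)] msqrt_carrier[OF assms(2)] by simp
    also have "dagger U * (msqrt n A * msqrt n B) * U = (rdiag n p * (E * rdiag n q)) * dagger E"
      unfolding P Q E_def using U V
      by (simp add: assoc_square[of _ n] cancel dagger_mult[of "dagger U" n n V n])
    also have "mtrace \<dots> = of_real (\<Sum>i<n. \<Sum>j<n. p i * q j * w i j)"
    proof -
      have "(rdiag n p * (E * rdiag n q)) $$ (i,j) * cnj (E $$ (i,j)) = of_real (p i * q j * w i j)"
        if "i < n" "j < n" for i j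
        unfolding w_def of_real_mult complex_norm_square using that E
        by (simp add: index_rdiag_mult[of _ n n] index_mult_rdiag[of _ n n] del: index_mult_mat(1))
      then show ?thesis
        using E by (simp add: mtrace_mult_dagger[of _ n n] del: of_real_mult index_mult_mat(1))
    qed
    finally show ?thesis by (simp add: affinity_def)
  qed
  \<comment> \<open>In the coordinates \<open>Z = U * Y * dagger V\<close> the identity matrix
    becomes \<open>E\<close>, so \<open>1\<^sub>m n - Z\<close> becomes \<open>E - Y\<close>. The
    form is then a sum of independent scalar problems, one for each entry of
    \<open>Y\<close>.\<close>
  have form: "pform n u A B (U * Y * dagger V)
      = (\<Sum>i<n. \<Sum>j<n. (p i)\<^sup>2 * (cmod (Y $$ (i,j)))\<^sup>2 + u\<^sup>2 * (q j)\<^sup>2 * (cmod (E $$ (i,j) - Y $$ (i,j)))\<^sup>2)"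
    if Y: "Y \<in> carrier_mat n n" for u Y
  proof -
    let ?Z = "U * Y * dagger V"
    have "mtrace (dagger ?Z * A * ?Z) = mtrace (dagger V * (dagger ?Z * A * ?Z) * V)"
      by (rule mtrace_unitary_conj[OF uV, symmetric]) (use U V Y psdD(1)[OF assms(1)] in simp)
    also have "dagger V * (dagger ?Z * A * ?Z) * V = dagger Y * rdiag n (\<lambda>i. (p i)\<^sup>2) * Y"
      unfolding A using U V Y
      by (simp add: assoc_square[of _ n] cancel dagger_mult[of U n n _ n] dagger_mult[of Y n n _ n])
    finally have 1: "Re (mtrace (dagger ?Z * A * ?Z)) = (\<Sum>i<n. \<Sum>j<n. (p i)\<^sup>2 * (cmod (Y $$ (i,j)))\<^sup>2)"
      using Y by (simp add: mtrace_rdiag_mult)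
    have EY: "1\<^sub>m n - ?Z = U * (E - Y) * dagger V"
    proof -
      have "U * (E - Y) * dagger V = U * E * dagger V - U * Y * dagger V"
        using U V E Y by (simp add: mult_minus_distrib_mat[of U n n] minus_mult_distrib_mat[of "U * E" n n "U * Y" "dagger V" n])
      also have "U * E * dagger V = 1\<^sub>m n"
        unfolding E_def using U V by (simp add: assoc_square[of _ n] cancel)
      finally show ?thesis ..
    qed
    have EYc: "E - Y \<in> carrier_mat n n" by (rule minus_carrier_mat[OF Y])
    have "mtrace ((1\<^sub>m n - ?Z) * B * dagger (1\<^sub>m n - ?Z))
        = mtrace (dagger U * ((1\<^sub>m n - ?Z) * B * dagger (1\<^sub>m n - ?Z)) * U)"
      by (rule mtrace_unitary_conj[OF uU, symmetric])
        (intro mult_carrier_square dagger_carrier minus_carrier_mat U(1) V(1) Y psdD(1)[OF assms(2)])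
    also have "dagger U * ((1\<^sub>m n - ?Z) * B * dagger (1\<^sub>m n - ?Z)) * U
        = (E - Y) * rdiag n (\<lambda>i. (q i)\<^sup>2) * dagger (E - Y)"
      unfolding EY B using U V EYc right_mult_one_mat[OF dagger_carrier[OF EYc]]
      by (simp add: assoc_square[of _ n] cancel dagger_mult[of U n n _ n] dagger_mult[of "E - Y" n n _ n])
    finally have 2: "Re (mtrace ((1\<^sub>m n - ?Z) * B * dagger (1\<^sub>m n - ?Z)))
        = (\<Sum>i<n. \<Sum>j<n. (q j)\<^sup>2 * (cmod (E $$ (i,j) - Y $$ (i,j)))\<^sup>2)"
      using mtrace_mult_rdiag[OF EYc, of "\<lambda>i. (q i)\<^sup>2"] E Y by simp
    show ?thesis
      unfolding pform_def 1 2 by (simp add: sum.distrib sum_distrib_left mult.assoc)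
  qed
  \<comment> \<open>Regrouped so that each coefficient is the parallel sum of
    \<open>(p i)\<^sup>2\<close> and \<open>u\<^sup>2 * (q j)\<^sup>2\<close>.\<close>
  have uJ: "u\<^sup>2 * J u = (\<Sum>i<n. \<Sum>j<n.
      (p i)\<^sup>2 * (u\<^sup>2 * (q j)\<^sup>2) / ((p i)\<^sup>2 + u\<^sup>2 * (q j)\<^sup>2) * (cmod (E $$ (i,j)))\<^sup>2)" for u
    unfolding J_def w_def sum_distrib_left by (intro sum.cong refl) (simp add: mult_ac)
  have lower: "u\<^sup>2 * J u \<le> pform n u A B Z" if Z: "Z \<in> carrier_mat n n" for u Z
  proof -
    define Y where "Y = dagger U * Z * V"
    have Y: "Y \<in> carrier_mat n n" using U V Z by (simp add: Y_def)
    have ZY: "Z = U * Y * dagger V"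
      unfolding Y_def using U V Z by (simp add: assoc_square[of _ n] cancel)
    show ?thesis
      unfolding uJ ZY form[OF Y] by (intro sum_mono parallel_le) auto
  qed
  have attained: "\<exists>Z\<in>carrier_mat n n. u\<^sup>2 * J u = pform n u A B Z" for u
  proof -
    \<comment> \<open>The scalar minimiser of \<open>parallel_eq\<close>, taken entry by
      entry.\<close>
    define Y where "Y = mat n n (\<lambda>(i,j). of_real (u\<^sup>2 * (q j)\<^sup>2 / ((p i)\<^sup>2 + u\<^sup>2 * (q j)\<^sup>2)) * E $$ (i,j))"
    have Y: "Y \<in> carrier_mat n n" by (simp add: Y_def)
    have Yi: "Y $$ (i,j) = of_real (u\<^sup>2 * (q j)\<^sup>2 / ((p i)\<^sup>2 + u\<^sup>2 * (q j)\<^sup>2)) * E $$ (i,j)"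
      if "i < n" "j < n" for i j using that by (simp add: Y_def)
    have "u\<^sup>2 * J u = pform n u A B (U * Y * dagger V)"
      unfolding uJ form[OF Y]
    proof (intro sum.cong refl)
      fix i j assume "i \<in> {..<n}" "j \<in> {..<n}"
      then show "(p i)\<^sup>2 * (u\<^sup>2 * (q j)\<^sup>2) / ((p i)\<^sup>2 + u\<^sup>2 * (q j)\<^sup>2) * (cmod (E $$ (i,j)))\<^sup>2
          = (p i)\<^sup>2 * (cmod (Y $$ (i,j)))\<^sup>2 + u\<^sup>2 * (q j)\<^sup>2 * (cmod (E $$ (i,j) - Y $$ (i,j)))\<^sup>2"
        using parallel_eq[of "(p i)\<^sup>2" "u\<^sup>2 * (q j)\<^sup>2" "E $$ (i,j)"] Yi[of i j] by simp
    qed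
    then show ?thesis by (rule bexI) (use U V Y in simp)
  qed
  have "(F has_real_derivative J u) (at u)" for u
    unfolding F_def J_def using p q
    by (intro DERIV_sum DERIV_cmult_right arctan_scaled_deriv) auto
  moreover have "(F \<longlongrightarrow> affinity n A B * (pi / 2)) at_top"
  proof -
    have "(F \<longlongrightarrow> (\<Sum>i<n. \<Sum>j<n. p i * q j * (pi / 2) * w i j)) at_top"
      unfolding F_def using p q by (intro tendsto_sum tendsto_mult tendsto_const arctan_scaled_limit) auto
    moreover have "(\<Sum>i<n. \<Sum>j<n. p i * q j * (pi / 2) * w i j) = affinity n A B * (pi / 2)"
      unfolding aff sum_distrib_right by (intro sum.cong refl) simp
    ultimately show ?thesis by (simp only:)
  qed
  moreover have "F 0 = 0" by (simp add: F_def)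
  ultimately show ?thesis using lower attained
    unfolding affinity_primitive_def by blast
qed

text \<open>Reduces an inequality between sums of affinities to one between forms at each fixed
  \<open>u > 0\<close>: for every choice of \<open>Z\<close> on the right some choice of
  \<open>Y\<close> on the left does no worse. This compares the minima, hence the integrands, hence
  the integrals.\<close>

lemma affinity_sum_mono:
  assumes psd: "\<And>i. i \<in> I \<Longrightarrow> psd n (A i) \<and> psd n (B i)" "\<And>k. k \<in> L \<Longrightarrow> psd n (C k) \<and> psd n (D k)"
    and le: "\<And>u Z. u > 0 \<Longrightarrow> (\<And>k. k \<in> L \<Longrightarrow> Z k \<in> carrier_mat n n) \<Longrightarrow>
      \<exists>Y. (\<forall>i\<in>I. Y i \<in> carrier_mat n n) \<and>
        (\<Sum>i\<in>I. pform n u (A i) (B i) (Y i)) \<le> (\<Sum>k\<in>L. pform n u (C k) (D k) (Z k))"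
  shows "(\<Sum>i\<in>I. affinity n (A i) (B i)) \<le> (\<Sum>k\<in>L. affinity n (C k) (D k))"
proof -
  have "\<forall>i\<in>I. \<exists>F J. affinity_primitive n (A i) (B i) F J"
    using affinity_primitive_exists psd by blast
  from bchoice[OF this] obtain F where "\<forall>i\<in>I. \<exists>J. affinity_primitive n (A i) (B i) (F i) J" ..
  from bchoice[OF this] obtain J where "\<forall>i\<in>I. affinity_primitive n (A i) (B i) (F i) (J i)" ..
  note F = bspec[OF this, unfolded affinity_primitive_def]
  have "\<forall>k\<in>L. \<exists>F J. affinity_primitive n (C k) (D k) F J"
    using affinity_primitive_exists psd by blast
  from bchoice[OF this] obtain G where "\<forall>k\<in>L. \<exists>J. affinity_primitive n (C k) (D k) (G k) J" ..
  from bchoice[OF this] obtain K where "\<forall>k\<in>L. affinity_primitive n (C k) (D k) (G k) (K k)" ..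
  note G = bspec[OF this, unfolded affinity_primitive_def]
  have JK: "(\<Sum>i\<in>I. J i u) \<le> (\<Sum>k\<in>L. K k u)" if u: "u > 0" for u
  proof -
    \<comment> \<open>On the right the minimisers are taken; on the left any \<open>Y\<close> bounds
      the minima from above.\<close>
    have "\<forall>k\<in>L. \<exists>Z. Z \<in> carrier_mat n n \<and> u\<^sup>2 * K k u = pform n u (C k) (D k) Z"
      using G by blast
    from bchoice[OF this] obtain Z where
      Z: "\<forall>k\<in>L. Z k \<in> carrier_mat n n \<and> u\<^sup>2 * K k u = pform n u (C k) (D k) (Z k)" ..
    obtain Y where Y: "\<forall>i\<in>I. Y i \<in> carrier_mat n n"
      "(\<Sum>i\<in>I. pform n u (A i) (B i) (Y i)) \<le> (\<Sum>k\<in>L. pform n u (C k) (D k) (Z k))"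
      using le[OF u, of Z] Z by blast
    have "u\<^sup>2 * (\<Sum>i\<in>I. J i u) = (\<Sum>i\<in>I. u\<^sup>2 * J i u)" by (simp add: sum_distrib_left)
    also have "\<dots> \<le> (\<Sum>i\<in>I. pform n u (A i) (B i) (Y i))" using F Y(1) by (intro sum_mono) auto
    also note Y(2)
    also have "(\<Sum>k\<in>L. pform n u (C k) (D k) (Z k)) = u\<^sup>2 * (\<Sum>k\<in>L. K k u)"
      using Z by (simp add: sum_distrib_left)
    finally show ?thesis using u by (simp add: mult_le_cancel_left)
  qed
  define H where "H u = (\<Sum>k\<in>L. G k u) - (\<Sum>i\<in>I. F i u)" for u
  have H': "(H has_real_derivative ((\<Sum>k\<in>L. K k u) - (\<Sum>i\<in>I. J i u))) (at u)" for u
    unfolding H_def using F G by (intro DERIV_diff DERIV_sum) auto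
  have Hpos: "H u \<ge> 0" if "u > 0" for u
  proof -
    \<comment> \<open>The derivative is known to be nonnegative only at positive arguments;
      continuity supplies the endpoint 0.\<close>
    have "H 0 \<le> H u"
    proof (rule DERIV_nonneg_imp_increasing_open[of 0 u H])
      show "continuous_on {0..u} H" by (intro continuous_at_imp_continuous_on ballI DERIV_isCont[OF H'])
      fix x assume "0 < x" "x < u"
      then show "\<exists>y. (H has_real_derivative y) (at x) \<and> 0 \<le> y" using H'[of x] JK[of x] by auto
    qed (use that in simp)
    moreover have "H 0 = 0" using F G by (simp add: H_def)
    ultimately show ?thesis by simp
  qed
  have "eventually (\<lambda>u. 0 \<le> H u) at_top"
    using eventually_gt_at_top[of 0] by (rule eventually_mono) (rule Hpos)
  moreover have "(H \<longlongrightarrow> (\<Sum>k\<in>L. affinity n (C k) (D k) * (pi / 2)) - (\<Sum>i\<in>I. affinity n (A i) (B i) * (pi / 2))) at_top"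
    unfolding H_def using F G by (intro tendsto_diff tendsto_sum) auto
  ultimately have "0 \<le> (\<Sum>k\<in>L. affinity n (C k) (D k) * (pi / 2)) - (\<Sum>i\<in>I. affinity n (A i) (B i) * (pi / 2))"
    by (intro tendsto_lowerbound) auto
  then have "0 \<le> ((\<Sum>k\<in>L. affinity n (C k) (D k)) - (\<Sum>i\<in>I. affinity n (A i) (B i))) * (pi / 2)"
    by (simp only: sum_distrib_right left_diff_distrib)
  then show ?thesis using pi_gt_zero by (auto simp: zero_le_mult_iff)
qed

subsection \<open>Joint concavity and monotonicity of the affinity\<close>

lemma mtrace_conj_mat_sum:
  assumes "X \<in> carrier_mat n n" "Y \<in> carrier_mat n n" "\<And>k. k \<in> I \<Longrightarrow> F k \<in> carrier_mat n n"
  shows "mtrace (X * mat_sum n I F * Y) = (\<Sum>k\<in>I. mtrace (X * F k * Y))"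
  using assms by (simp add: mult_mat_sum_left mult_mat_sum_right mtrace_mat_sum)

text \<open>The form is linear in the pair of matrices, so one \<open>Z\<close> for the summed pair
  serves for every summand: a minimum of a sum is at least the sum of the minima.\<close>

theorem affinity_superadditive:
  assumes psd: "\<And>i. i \<in> I \<Longrightarrow> psd n (A i)" "\<And>i. i \<in> I \<Longrightarrow> psd n (B i)"
  shows "(\<Sum>i\<in>I. affinity n (A i) (B i)) \<le> affinity n (mat_sum n I A) (mat_sum n I B)"
proof -
  have "(\<Sum>i\<in>I. affinity n (A i) (B i)) \<le> (\<Sum>k\<in>{()}. affinity n (mat_sum n I A) (mat_sum n I B))"
  proof (rule affinity_sum_mono)
    fix u :: real and Z :: "unit \<Rightarrow> complex mat" assume "\<And>k. k \<in> {()} \<Longrightarrow> Z k \<in> carrier_mat n n"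
    then have Z: "Z () \<in> carrier_mat n n" by simp
    have "pform n u (mat_sum n I A) (mat_sum n I B) (Z ()) = (\<Sum>i\<in>I. pform n u (A i) (B i) (Z ()))"
      unfolding pform_def using Z psdD(1)[OF psd(1)] psdD(1)[OF psd(2)]
      by (simp add: mtrace_conj_mat_sum minus_carrier_mat sum.distrib sum_distrib_left)
    with Z show "\<exists>Y. (\<forall>i\<in>I. Y i \<in> carrier_mat n n) \<and> (\<Sum>i\<in>I. pform n u (A i) (B i) (Y i))
        \<le> (\<Sum>k\<in>{()}. pform n u (mat_sum n I A) (mat_sum n I B) (Z k))"
      by (intro exI[of _ "\<lambda>_. Z ()"]) simp
  qed (use psd in \<open>auto intro: psd_mat_sum\<close>)
  then show ?thesis by simp
qed

text \<open>Stacking the Kraus operators in a column gives an isometry, and multiplying the row of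
  the \<open>Y k\<close> by it cannot increase the norm. Concretely, the squared norm of the sum
  \<open>X\<close> is the sum of the inner products of \<open>Y k\<close> with
  \<open>X * dagger (K k)\<close>, and the squared norms of the latter add up to that of
  \<open>X\<close>.\<close>

lemma hs2_kraus_le:
  assumes K: "kraus n r K" and Y: "\<And>k. k < r \<Longrightarrow> Y k \<in> carrier_mat n n"
  shows "hs2 (mat_sum n {..<r} (\<lambda>k. Y k * K k)) \<le> (\<Sum>k<r. hs2 (Y k))"
proof -
  have Kc: "K k \<in> carrier_mat n n" if "k < r" for k using K that by (simp add: kraus_def)
  define X where "X = mat_sum n {..<r} (\<lambda>k. Y k * K k)"
  have X: "X \<in> carrier_mat n n" by (simp add: X_def)
  have "(\<Sum>k<r. hs2 (X * dagger (K k))) = (\<Sum>k<r. Re (mtrace (X * (dagger (K k) * K k) * dagger X)))"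
  proof (rule sum.cong[OF refl])
    fix k assume "k \<in> {..<r}"
    then have k: "K k \<in> carrier_mat n n" using Kc by simp
    have "(X * dagger (K k)) * dagger (X * dagger (K k)) = X * (dagger (K k) * K k) * dagger X"
      using X k by (simp add: dagger_mult[of X n n _ n] assoc_square[of _ n])
    then show "hs2 (X * dagger (K k)) = Re (mtrace (X * (dagger (K k) * K k) * dagger X))"
      using mtrace_self_dagger[of "X * dagger (K k)"] by simp
  qed
  also have "\<dots> = Re (mtrace (X * mat_sum n {..<r} (\<lambda>k. dagger (K k) * K k) * dagger X))"
    using X Kc by (subst mtrace_conj_mat_sum) auto
  also have "\<dots> = hs2 X"
    using X K by (simp add: kraus_def mtrace_self_dagger)
  finally have XK: "(\<Sum>k<r. hs2 (X * dagger (K k))) = hs2 X" .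
  have "hs2 X = Re (mtrace (1\<^sub>m n * X * dagger X))"
    using X by (simp add: mtrace_self_dagger)
  also have "\<dots> = (\<Sum>k<r. Re (mtrace (1\<^sub>m n * (Y k * K k) * dagger X)))"
    using mtrace_conj_mat_sum[of "1\<^sub>m n" n "dagger X" "{..<r}" "\<lambda>k. Y k * K k"] X Y Kc
    by (simp flip: X_def)
  also have "\<dots> \<le> (\<Sum>k<r. (hs2 (Y k) + hs2 (X * dagger (K k))) / 2)"
  proof (rule sum_mono)
    fix k assume "k \<in> {..<r}"
    then have k: "K k \<in> carrier_mat n n" "Y k \<in> carrier_mat n n" using Kc Y by auto
    have "1\<^sub>m n * (Y k * K k) * dagger X = Y k * dagger (X * dagger (K k))"
      using X k left_mult_one_mat[of "Y k * K k" n n]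
      by (simp add: dagger_mult[of X n n _ n] assoc_square[of _ n])
    then have "Re (mtrace (1\<^sub>m n * (Y k * K k) * dagger X)) \<le> sqrt (hs2 (Y k)) * sqrt (hs2 (X * dagger (K k)))"
      using mtrace_Cauchy_Schwarz[of "Y k" n n "X * dagger (K k)"] k X by simp
    also have "\<dots> \<le> (hs2 (Y k) + hs2 (X * dagger (K k))) / 2"
      using arith_geo_mean_sqrt[of "hs2 (Y k)" "hs2 (X * dagger (K k))"] by (simp add: hs2_nonneg real_sqrt_mult)
    finally show "Re (mtrace (1\<^sub>m n * (Y k * K k) * dagger X)) \<le> (hs2 (Y k) + hs2 (X * dagger (K k))) / 2" .
  qed
  \<comment> \<open>\<open>hs2 X\<close> occurs on both sides; absorbing its half gives the
    claim.\<close>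
  also have "\<dots> = ((\<Sum>k<r. hs2 (Y k)) + hs2 X) / 2"
    by (simp add: XK sum.distrib flip: sum_divide_distrib)
  finally show ?thesis by (simp add: X_def)
qed

text \<open>With \<open>P\<close> the root of \<open>A\<close>, the left side is the squared norm of
  \<open>P * X\<close>, which is a sum of \<open>P * dagger (K k) * Z k\<close> times
  \<open>K k\<close>, as in \<open>hs2_kraus_le\<close>.\<close>

lemma mtrace_kraus_le:
  assumes K: "kraus n r K" and A: "psd n A" and Z: "\<And>k. k < r \<Longrightarrow> Z k \<in> carrier_mat n n"
  defines "X \<equiv> mat_sum n {..<r} (\<lambda>k. dagger (K k) * Z k * K k)"
  shows "Re (mtrace (dagger X * A * X)) \<le> (\<Sum>k<r. Re (mtrace (dagger (Z k) * (K k * A * dagger (K k)) * Z k)))"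
proof -
  have Kc: "K k \<in> carrier_mat n n" if "k < r" for k using K that by (simp add: kraus_def)
  define P where "P = msqrt n A"
  have P: "P \<in> carrier_mat n n" "dagger P = P" "P * P = A"
    unfolding P_def using A by (auto intro: msqrt msqrt_carrier msqrt_dagger)
  have sq: "Re (mtrace (dagger W * A * W)) = hs2 (P * W)" if "W \<in> carrier_mat n n" for W
  proof -
    have "dagger (P * W) * (P * W) = dagger W * A * W"
      unfolding P(3)[symmetric] using P(1,2) that by (simp add: dagger_mult[of P n n _ n] assoc_square[of _ n])
    then show ?thesis using mtrace_dagger_self[of "P * W"] by simp
  qed
  have "P * X = mat_sum n {..<r} (\<lambda>k. (P * dagger (K k) * Z k) * K k)"
    unfolding X_def using P(1) Z Kc
    by (subst mult_mat_sum_left) (auto intro!: mat_sum_cong simp: assoc_square[of _ n])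
  then have "hs2 (P * X) \<le> (\<Sum>k<r. hs2 (P * dagger (K k) * Z k))"
    using hs2_kraus_le[OF K, of "\<lambda>k. P * dagger (K k) * Z k"] P(1) Z Kc by simp
  also have "\<dots> = (\<Sum>k<r. Re (mtrace (dagger (Z k) * (K k * A * dagger (K k)) * Z k)))"
  proof (rule sum.cong[OF refl])
    fix k assume "k \<in> {..<r}"
    then have k: "K k \<in> carrier_mat n n" "Z k \<in> carrier_mat n n" using Kc Z by auto
    have Ac: "A \<in> carrier_mat n n" using A by (rule psdD)
    have "dagger (dagger (K k) * Z k) * A * (dagger (K k) * Z k) = dagger (Z k) * (K k * A * dagger (K k)) * Z k"
      using k Ac by (simp add: dagger_mult[of _ n n _ n] assoc_square[of _ n])
    moreover have "P * dagger (K k) * Z k = P * (dagger (K k) * Z k)"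
      using k P by (simp add: assoc_square[of _ n])
    ultimately show "hs2 (P * dagger (K k) * Z k) = Re (mtrace (dagger (Z k) * (K k * A * dagger (K k)) * Z k))"
      using sq[of "dagger (K k) * Z k"] k by simp
  qed
  finally show ?thesis using sq[of X] by (simp add: X_def)
qed

text \<open>Test matrices \<open>Z k\<close> for the outcomes are pulled back to \<open>X\<close> by
  the adjoint of the channel. Completeness makes \<open>1\<^sub>m n - X\<close> the pullback of the
  \<open>1\<^sub>m n - Z k\<close>, so \<open>mtrace_kraus_le\<close> bounds both terms of the
  form.\<close>

theorem affinity_kraus_mono:
  assumes K: "kraus n r K" and A: "psd n A" and B: "psd n B"
  shows "affinity n A B \<le> (\<Sum>k<r. affinity n (K k * A * dagger (K k)) (K k * B * dagger (K k)))"
proof -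
  have Kc: "K k \<in> carrier_mat n n" if "k < r" for k using K that by (simp add: kraus_def)
  have "(\<Sum>i\<in>{()}. affinity n A B) \<le> (\<Sum>k<r. affinity n (K k * A * dagger (K k)) (K k * B * dagger (K k)))"
  proof (rule affinity_sum_mono)
    fix u :: real and Z :: "nat \<Rightarrow> complex mat" assume "\<And>k. k \<in> {..<r} \<Longrightarrow> Z k \<in> carrier_mat n n"
    then have Z: "Z k \<in> carrier_mat n n" if "k < r" for k using that by simp
    define X where "X = mat_sum n {..<r} (\<lambda>k. dagger (K k) * Z k * K k)"
    \<comment> \<open>The second term of the form has its adjoint on the right, so
      \<open>mtrace_kraus_le\<close> is applied to the adjoints.\<close>
    let ?W = "\<lambda>k. dagger (1\<^sub>m n - Z k)"
    have W: "?W k \<in> carrier_mat n n" if "k < r" for k using Z[OF that] by (simp add: minus_carrier_mat)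
    have "1\<^sub>m n - X = mat_sum n {..<r} (\<lambda>k. dagger (K k) * K k) - X"
      using K by (simp add: kraus_def)
    also have "\<dots> = mat_sum n {..<r} (\<lambda>k. dagger (K k) * K k - dagger (K k) * Z k * K k)"
      unfolding X_def using Kc Z by (intro mat_sum_minus[symmetric]) auto
    also have "\<dots> = mat_sum n {..<r} (\<lambda>k. dagger (K k) * (1\<^sub>m n - Z k) * K k)"
    proof (rule mat_sum_cong)
      fix k assume "k \<in> {..<r}"
      then have k: "K k \<in> carrier_mat n n" "Z k \<in> carrier_mat n n" using Kc Z by auto
      then show "dagger (K k) * K k - dagger (K k) * Z k * K k = dagger (K k) * (1\<^sub>m n - Z k) * K k"
        by (simp add: mult_minus_distrib_mat[of _ n n _ n] minus_mult_distrib_mat[of _ n n _ _ n])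
    qed
    finally have "dagger (1\<^sub>m n - X) = mat_sum n {..<r} (\<lambda>k. dagger (dagger (K k) * (1\<^sub>m n - Z k) * K k))"
      using Kc Z by (subst dagger_mat_sum[symmetric]) (auto simp: minus_carrier_mat)
    also have "\<dots> = mat_sum n {..<r} (\<lambda>k. dagger (K k) * ?W k * K k)"
    proof (rule mat_sum_cong)
      fix k assume "k \<in> {..<r}"
      then have k: "K k \<in> carrier_mat n n" "1\<^sub>m n - Z k \<in> carrier_mat n n" using Kc Z by (auto simp: minus_carrier_mat)
      then show "dagger (dagger (K k) * (1\<^sub>m n - Z k) * K k) = dagger (K k) * ?W k * K k"
        by (simp add: dagger_mult[of _ n n _ n] assoc_square[of _ n])
    qed
    finally have WX: "dagger (1\<^sub>m n - X) = mat_sum n {..<r} (\<lambda>k. dagger (K k) * ?W k * K k)" .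
    have "pform n u A B X \<le> (\<Sum>k<r. pform n u (K k * A * dagger (K k)) (K k * B * dagger (K k)) (Z k))"
      using mtrace_kraus_le[OF K A, of Z] Z mtrace_kraus_le[OF K B, of ?W] W
      unfolding pform_def sum.distrib sum_distrib_left[symmetric] X_def[symmetric] WX[symmetric] dagger_dagger
      by (intro add_mono mult_left_mono) auto
    then show "\<exists>Y. (\<forall>i\<in>{()}. Y i \<in> carrier_mat n n) \<and> (\<Sum>i\<in>{()}. pform n u A B (Y i))
        \<le> (\<Sum>k<r. pform n u (K k * A * dagger (K k)) (K k * B * dagger (K k)) (Z k))"
      by (intro exI[of _ "\<lambda>_. X"]) (simp add: X_def)
  qed (use A B Kc in \<open>auto intro: psd_conj\<close>)
  then show ?thesis by simp
qed

subsection \<open>Dephasing\<close>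

lemma proj_a_eq_rdiag: "proj_a da db i = rdiag (da * db) (\<lambda>r. if r div db = i then 1 else 0)"
  by (rule eq_matI) (auto simp: proj_a_def rdiag_def)

lemma dephase_carrier[simp]: "dephase_a da db X \<in> carrier_mat (da * db) (da * db)"
  by (simp add: dephase_a_def)

lemma dim_dephase[simp]: "dim_row (dephase_a da db X) = da * db" "dim_col (dephase_a da db X) = da * db"
  using dephase_carrier[of da db X] by (auto simp del: dephase_carrier)

text \<open>Index \<open>r\<close> lies in block \<open>r div db\<close>; only the projector onto
  that block keeps row \<open>r\<close>. Dephasing thus erases the entries between different
  blocks.\<close>

lemma index_dephase:
  assumes X: "X \<in> carrier_mat (da * db) (da * db)" and rc: "r < da * db" "c < da * db"
  shows "dephase_a da db X $$ (r,c) = (if r div db = c div db then X $$ (r,c) else 0)"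
proof -
  have "(proj_a da db i * X * proj_a da db i) $$ (r,c)
      = (if i = r div db then (if r div db = c div db then X $$ (r,c) else 0) else 0)" for i
    unfolding proj_a_eq_rdiag using X rc
    by (subst index_mult_rdiag[of _ "da * db" "da * db"], simp_all add: index_rdiag_mult[of _ "da * db" "da * db"] del: index_mult_mat(1))
  moreover have "r div db < da" using rc(1) by (rule less_mult_imp_div_less)
  ultimately show ?thesis using rc by (simp add: dephase_a_def)
qed

lemma dephase_eqI:
  assumes "X \<in> carrier_mat (da * db) (da * db)"
    "\<And>r c. r < da * db \<Longrightarrow> c < da * db \<Longrightarrow> r div db \<noteq> c div db \<Longrightarrow> X $$ (r,c) = 0"
  shows "dephase_a da db X = X"
  by (rule eq_matI) (use assms in \<open>auto simp: index_dephase\<close>)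

lemma dephase_eqD:
  assumes "X \<in> carrier_mat (da * db) (da * db)" "dephase_a da db X = X"
    "r < da * db" "c < da * db" "r div db \<noteq> c div db"
  shows "X $$ (r,c) = 0"
  using index_dephase[OF assms(1,3,4)] assms(2,5) by simp

lemma dephase_idem[simp]:
  assumes "X \<in> carrier_mat (da * db) (da * db)"
  shows "dephase_a da db (dephase_a da db X) = dephase_a da db X"
  by (rule dephase_eqI) (use assms in \<open>auto simp: index_dephase\<close>)

lemma dephase_smult:
  assumes "X \<in> carrier_mat (da * db) (da * db)"
  shows "dephase_a da db (c \<cdot>\<^sub>m X) = c \<cdot>\<^sub>m dephase_a da db X"
  by (rule eq_matI) (use assms in \<open>auto simp: index_dephase\<close>)

lemma dephase_mult:
  assumes X: "X \<in> carrier_mat (da * db) (da * db)" "dephase_a da db X = X"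
    and Y: "Y \<in> carrier_mat (da * db) (da * db)" "dephase_a da db Y = Y"
  shows "dephase_a da db (X * Y) = X * Y"
proof (rule dephase_eqI)
  fix r c assume rc: "r < da * db" "c < da * db" "r div db \<noteq> c div db"
  have "X $$ (r,k) * Y $$ (k,c) = 0" if "k < da * db" for k
    using dephase_eqD[OF X rc(1) that] dephase_eqD[OF Y that rc(2)] rc(3) by force
  then have "(\<Sum>k = 0..<da * db. X $$ (r,k) * Y $$ (k,c)) = 0" by (intro sum.neutral) simp
  then show "(X * Y) $$ (r,c) = 0" using X(1) Y(1) rc by (simp add: scalar_prod_def)
qed (use X Y in simp)

lemma psd_dephase:
  assumes "psd (da * db) A"
  shows "psd (da * db) (dephase_a da db A)"
proof -
  have "psd (da * db) (proj_a da db i * A * proj_a da db i)" for i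
    using psd_conj[OF assms, of "proj_a da db i"] by (simp add: proj_a_eq_rdiag)
  then show ?thesis unfolding dephase_a_def by (intro psd_mat_sum)
qed

lemma mtrace_dephase:
  assumes "X \<in> carrier_mat (da * db) (da * db)"
  shows "mtrace (dephase_a da db X) = mtrace X"
  using assms by (simp add: mtrace_def index_dephase)

text \<open>The entries that dephasing removes from \<open>X\<close> meet zeros of
  \<open>Y\<close>.\<close>

lemma mtrace_dephase_mult_dagger:
  assumes X: "X \<in> carrier_mat (da * db) (da * db)"
    and Y: "Y \<in> carrier_mat (da * db) (da * db)" "dephase_a da db Y = Y"
  shows "mtrace (X * dagger Y) = mtrace (dephase_a da db X * dagger Y)"
proof -
  have "X $$ (i,j) * cnj (Y $$ (i,j)) = dephase_a da db X $$ (i,j) * cnj (Y $$ (i,j))"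
    if "i < da * db" "j < da * db" for i j
    using that X dephase_eqD[OF Y that] by (simp add: index_dephase)
  then show ?thesis
    unfolding mtrace_mult_dagger[OF X Y(1)] mtrace_mult_dagger[OF dephase_carrier Y(1)]
    by (intro sum.cong refl) simp
qed

text \<open>Pythagoras: the two parts of \<open>X\<close> have disjoint supports.\<close>

lemma hs2_dephase:
  assumes "X \<in> carrier_mat (da * db) (da * db)"
  shows "hs2 X = hs2 (dephase_a da db X) + hs2 (X - dephase_a da db X)"
proof -
  let ?N = "da * db" and ?D = "dephase_a da db X"
  have dims: "hs2 Y = (\<Sum>i<?N. \<Sum>j<?N. (cmod (Y $$ (i,j)))\<^sup>2)" if "Y \<in> carrier_mat ?N ?N" for Y
    using that by (simp add: hs2_def)
  have "(cmod (X $$ (i,j)))\<^sup>2 = (cmod (?D $$ (i,j)))\<^sup>2 + (cmod ((X - ?D) $$ (i,j)))\<^sup>2"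
    if "i < ?N" "j < ?N" for i j
    using that index_dephase[OF assms that] by simp
  then show ?thesis
    unfolding dims[OF assms] dims[OF dephase_carrier] dims[OF minus_carrier_mat[OF dephase_carrier]]
      sum.distrib[symmetric]
    by (intro sum.cong refl) simp
qed

text \<open>A block diagonal matrix commutes with the projector onto each block, hence so does its
  root. For the block of \<open>r\<close>, comparing entry \<open>(r,c)\<close> of the two products
  gives 0 on one side and the entry of the root on the other.\<close>

lemma dephase_msqrt:
  assumes A: "psd (da * db) A" "dephase_a da db A = A"
  shows "dephase_a da db (msqrt (da * db) A) = msqrt (da * db) A"
proof (rule dephase_eqI)
  let ?N = "da * db" and ?S = "msqrt (da * db) A"
  note Ac = psdD(1)[OF A(1)]
  show S: "?S \<in> carrier_mat ?N ?N" using A(1) by (rule msqrt_carrier)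
  fix r c assume rc: "r < ?N" "c < ?N" "r div db \<noteq> c div db"
  define d where "d x = (if x div db = r div db then 1 else 0 :: real)" for x
  have "A * rdiag ?N d = rdiag ?N d * A"
  proof (rule eq_matI)
    fix i j assume "i < dim_row (rdiag ?N d * A)" "j < dim_col (rdiag ?N d * A)"
    then have ij: "i < ?N" "j < ?N" using Ac by auto
    show "(A * rdiag ?N d) $$ (i,j) = (rdiag ?N d * A) $$ (i,j)"
      unfolding index_mult_rdiag[OF Ac ij] index_rdiag_mult[OF Ac ij]
      using dephase_eqD[OF Ac A(2) ij] by (auto simp: d_def)
  qed (use Ac in auto)
  then have "?S * rdiag ?N d = rdiag ?N d * ?S"
    using sqrt_intertwine[OF msqrt(1) msqrt(1), of ?N A A "rdiag ?N d"] A(1) by (simp add: msqrt)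
  then have "(?S * rdiag ?N d) $$ (r,c) = (rdiag ?N d * ?S) $$ (r,c)" by simp
  then show "?S $$ (r,c) = 0"
    unfolding index_mult_rdiag[OF S rc(1,2)] index_rdiag_mult[OF S rc(1,2)] using rc(3) by (simp add: d_def)
qed

subsection \<open>The closed form of the affinity coherence\<close>

text \<open>With \<open>R\<close> the fourth root of \<open>A\<close>, cyclicity turns the trace
  into that of the positive semidefinite \<open>R * msqrt n B * dagger R\<close>.\<close>

lemma affinity_nonneg:
  assumes "psd n A" "psd n B"
  shows "affinity n A B \<ge> 0"
proof -
  note P = msqrt[OF assms(1)] and Q = msqrt[OF assms(2)]
  define R where "R = msqrt n (msqrt n A)"
  have R: "R \<in> carrier_mat n n" "R * R = msqrt n A" "dagger R = R"
    unfolding R_def using msqrt[OF P(1)] msqrt_carrier[OF P(1)] msqrt_dagger[OF P(1)] by auto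
  note Qc = psdD(1)[OF Q(1)]
  have "mtrace (msqrt n A * msqrt n B) = mtrace (R * (R * msqrt n B))"
    unfolding R(2)[symmetric] assoc_square[OF R(1,1) Qc] ..
  also have "\<dots> = mtrace (R * msqrt n B * dagger R)"
    using R(1,3) Qc mtrace_mult_comm[of R n n "R * msqrt n B"] by simp
  finally show ?thesis
    using Re_mtrace_psd[OF psd_conj[OF Q(1) R(1)]] by (simp add: affinity_def hs2_nonneg)
qed

text \<open>For a density matrix this is the largest squared affinity with a partial incoherent
  state, that is, one minus the coherence.\<close>

definition block_weight :: "nat \<Rightarrow> nat \<Rightarrow> complex mat \<Rightarrow> real" where
  "block_weight da db A = hs2 (dephase_a da db (msqrt (da * db) A))"

lemma block_weight_nonneg: "block_weight da db A \<ge> 0"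
  by (simp add: block_weight_def hs2_nonneg)

text \<open>Cauchy-Schwarz after dephasing the root of \<open>A\<close>. \<open>B\<close> is left
  unnormalised, since Kraus outcomes and weighted members of an ensemble are.\<close>

lemma affinity_le_block_weight:
  assumes A: "psd (da * db) A" and B: "psd (da * db) B" "dephase_a da db B = B"
  shows "affinity (da * db) A B \<le> sqrt (block_weight da db A) * sqrt (Re (mtrace B))"
proof -
  note S = msqrt_carrier[OF A] msqrt_carrier[OF B(1)]
  have "affinity (da * db) A B
      = Re (mtrace (dephase_a da db (msqrt (da * db) A) * dagger (msqrt (da * db) B)))"
    unfolding affinity_self_adjoint[OF A B(1)]
    using mtrace_dephase_mult_dagger[OF S dephase_msqrt[OF B]] by simp
  also have "\<dots> \<le> sqrt (block_weight da db A) * sqrt (hs2 (msqrt (da * db) B))"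
    unfolding block_weight_def by (rule mtrace_Cauchy_Schwarz) (use S in auto)
  finally show ?thesis by (simp add: Re_mtrace_psd[OF B(1)])
qed

text \<open>The equality case of that bound: its root is the dephased root of \<open>A\<close>.
  Without normalisation it also makes sense when the weight is zero.\<close>

definition block_witness :: "nat \<Rightarrow> nat \<Rightarrow> complex mat \<Rightarrow> complex mat" where
  "block_witness da db A =
     dephase_a da db (msqrt (da * db) A) * dephase_a da db (msqrt (da * db) A)"

lemma block_witness:
  assumes A: "psd (da * db) A"
  shows "psd (da * db) (block_witness da db A)"
    and "dephase_a da db (block_witness da db A) = block_witness da db A"
    and "mtrace (block_witness da db A) = of_real (block_weight da db A)"
    and "affinity (da * db) A (block_witness da db A) = block_weight da db A"
proof -
  let ?N = "da * db"
  define S where "S = dephase_a da db (msqrt ?N A)"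
  have S: "psd ?N S" unfolding S_def by (intro psd_dephase msqrt A)
  note Sc = psdD(1)[OF S] and Sd = psdD(3)[OF S]
  have DS: "dephase_a da db S = S" unfolding S_def using msqrt_carrier[OF A] by simp
  have W: "block_witness da db A = S * S" by (simp add: block_witness_def S_def)
  have SS: "S * S = S * dagger S" by (simp add: Sd)
  show "psd ?N (block_witness da db A)"
    unfolding W SS by (rule psd_gram[OF Sc])
  then have root: "msqrt ?N (block_witness da db A) = S" unfolding W by (intro msqrt_eqI S) simp
  show "dephase_a da db (block_witness da db A) = block_witness da db A"
    unfolding W by (rule dephase_mult) (use Sc DS in auto)
  show tr: "mtrace (block_witness da db A) = of_real (block_weight da db A)"
    unfolding W SS mtrace_self_dagger by (simp add: block_weight_def S_def)
  have "affinity ?N A (block_witness da db A) = Re (mtrace (msqrt ?N A * dagger S))"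
    by (simp add: affinity_def root Sd)
  also have "\<dots> = Re (mtrace (S * dagger S))"
    using mtrace_dephase_mult_dagger[OF msqrt_carrier[OF A] Sc DS] by (simp add: S_def)
  also have "\<dots> = block_weight da db A"
    unfolding mtrace_self_dagger block_weight_def S_def by simp
  finally show "affinity ?N A (block_witness da db A) = block_weight da db A" .
qed

lemma block_weight_smult:
  assumes "psd (da * db) A" "c \<ge> 0"
  shows "block_weight da db (of_real c \<cdot>\<^sub>m A) = c * block_weight da db A"
proof -
  have "hs2 (of_real (sqrt c) \<cdot>\<^sub>m X) = c * hs2 X" for X
    using assms(2) by (simp add: hs2_def norm_mult power_mult_distrib sum_distrib_left)
  then show ?thesis
    unfolding block_weight_def msqrt_smult[OF assms] using msqrt_carrier[OF assms(1)]
    by (simp add: dephase_smult)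
qed

text \<open>Permits normalising the witness. Dephasing preserves the trace, so weight zero would
  make the root of \<open>A\<close> traceless, hence zero, against
  \<open>mtrace A = 1\<close>.\<close>

lemma block_weight_pos:
  assumes "density (da * db) A"
  shows "block_weight da db A > 0"
proof (rule ccontr)
  have A: "psd (da * db) A" "mtrace A = 1" using assms by (auto simp: density_def)
  assume "\<not> block_weight da db A > 0"
  then have "hs2 (dephase_a da db (msqrt (da * db) A)) = 0"
    using block_weight_nonneg[of da db A] by (simp add: block_weight_def)
  then have "dephase_a da db (msqrt (da * db) A) = 0\<^sub>m (da * db) (da * db)"
    by (intro hs2_eq_0) auto
  then have "mtrace (msqrt (da * db) A) = 0"
    using mtrace_dephase[OF msqrt_carrier[OF A(1)]] by (simp add: mtrace_def)
  then have "msqrt (da * db) A = 0\<^sub>m (da * db) (da * db)"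
    by (intro psd_trace_0 msqrt A) simp
  then have "hs2 (msqrt (da * db) A) = 0" by (simp add: hs2_def)
  then show False using A by (simp add: mtrace_psd)
qed

lemma optimal_state:
  assumes "density (da * db) \<rho>"
  shows "\<exists>\<sigma>\<in>IP da db. affinity (da * db) \<rho> \<sigma> = sqrt (block_weight da db \<rho>)"
proof -
  have \<rho>: "psd (da * db) \<rho>" using assms by (simp add: density_def)
  note W = block_witness[OF \<rho>]
  define M where "M = block_weight da db \<rho>"
  have M: "M > 0" using block_weight_pos[OF assms] by (simp add: M_def)
  define \<sigma> where "\<sigma> = of_real (1 / M) \<cdot>\<^sub>m block_witness da db \<rho>"
  have "psd (da * db) \<sigma>" unfolding \<sigma>_def using W(1) M by (intro psd_smult) auto
  moreover have "mtrace \<sigma> = 1"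
    unfolding \<sigma>_def using mtrace_smult[OF psdD(1)[OF W(1)]] W(3) M by (simp add: M_def)
  moreover have "dephase_a da db \<sigma> = \<sigma>"
    unfolding \<sigma>_def using dephase_smult[OF psdD(1)[OF W(1)]] W(2) by simp
  ultimately have "\<sigma> \<in> IP da db" by (simp add: IP_def density_def)
  moreover have "affinity (da * db) \<rho> \<sigma> = sqrt M"
  proof -
    \<comment> \<open>The factor 1 brings the first argument into the form required by
      \<open>affinity_smult\<close>.\<close>
    have "affinity (da * db) \<rho> \<sigma> = affinity (da * db) (of_real 1 \<cdot>\<^sub>m \<rho>) \<sigma>"
      using psdD(1)[OF \<rho>] by (auto intro!: arg_cong[where f = "\<lambda>X. affinity (da * db) X \<sigma>"] eq_matI)
    also have "\<dots> = sqrt 1 * sqrt (1 / M) * M"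
      unfolding \<sigma>_def using affinity_smult[OF \<rho> W(1), of 1 "1 / M"] W(4) M by (simp add: M_def)
    also have "\<dots> = sqrt M" using M by (simp add: real_sqrt_divide real_div_sqrt)
    finally show ?thesis .
  qed
  ultimately show ?thesis unfolding M_def by blast
qed

theorem CA_eq:
  assumes "density (da * db) \<rho>"
  shows "CA da db \<rho> = 1 - block_weight da db \<rho>"
  unfolding CA_def
proof (rule cInf_eq_minimum)
  obtain \<sigma> where "\<sigma> \<in> IP da db" "affinity (da * db) \<rho> \<sigma> = sqrt (block_weight da db \<rho>)"
    using optimal_state[OF assms] by blast
  then show "1 - block_weight da db \<rho> \<in> (\<lambda>\<sigma>. 1 - (affinity (da * db) \<rho> \<sigma>)\<^sup>2) ` IP da db"
    by (intro image_eqI[of _ _ \<sigma>]) (auto simp: block_weight_nonneg)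
  fix x assume "x \<in> (\<lambda>\<sigma>. 1 - (affinity (da * db) \<rho> \<sigma>)\<^sup>2) ` IP da db"
  then obtain \<sigma> where \<sigma>: "psd (da * db) \<sigma>" "mtrace \<sigma> = 1" "dephase_a da db \<sigma> = \<sigma>"
    and x: "x = 1 - (affinity (da * db) \<rho> \<sigma>)\<^sup>2"
    by (auto simp: IP_def density_def)
  have \<rho>: "psd (da * db) \<rho>" using assms by (simp add: density_def)
  have "affinity (da * db) \<rho> \<sigma> \<le> sqrt (block_weight da db \<rho>)"
    using affinity_le_block_weight[OF \<rho> \<sigma>(1,3)] \<sigma>(2) by simp
  \<comment> \<open>Squaring the bound is legitimate because the affinity is nonnegative.\<close>
  then have "(affinity (da * db) \<rho> \<sigma>)\<^sup>2 \<le> block_weight da db \<rho>"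
    using affinity_nonneg[OF \<rho> \<sigma>(1)] power_mono[of _ _ 2] block_weight_nonneg[of da db \<rho>] by fastforce
  then show "1 - block_weight da db \<rho> \<le> x" using x by simp
qed

subsection \<open>Faithfulness, monotonicity and convexity\<close>

text \<open>The squared norm of the root of a state is 1 and splits into the weight and the squared
  norm of the off-block part, so weight 1 means that the root is block diagonal.\<close>

lemma block_weight_le_1_iff:
  assumes "density (da * db) \<rho>"
  shows "block_weight da db \<rho> \<le> 1" and "block_weight da db \<rho> = 1 \<longleftrightarrow> \<rho> \<in> IP da db"
proof -
  let ?S = "msqrt (da * db) \<rho>"
  have \<rho>: "psd (da * db) \<rho>" "mtrace \<rho> = 1" using assms by (auto simp: density_def)
  note S = msqrt_carrier[OF \<rho>(1)]
  have eq: "1 = block_weight da db \<rho> + hs2 (?S - dephase_a da db ?S)"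
    using hs2_dephase[OF S] Re_mtrace_psd[OF \<rho>(1)] \<rho>(2) by (simp add: block_weight_def)
  then show "block_weight da db \<rho> \<le> 1" using hs2_nonneg[of "?S - dephase_a da db ?S"] by linarith
  have "block_weight da db \<rho> = 1 \<longleftrightarrow> hs2 (?S - dephase_a da db ?S) = 0" using eq by linarith
  also have "\<dots> \<longleftrightarrow> dephase_a da db ?S = ?S"
  proof
    assume "hs2 (?S - dephase_a da db ?S) = 0"
    then have 0: "?S - dephase_a da db ?S = 0\<^sub>m (da * db) (da * db)"
      by (intro hs2_eq_0 minus_carrier_mat) auto
    show "dephase_a da db ?S = ?S"
    proof (rule eq_matI)
      fix i j assume "i < dim_row ?S" "j < dim_col ?S"
      then show "dephase_a da db ?S $$ (i,j) = ?S $$ (i,j)"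
        using arg_cong[OF 0, of "\<lambda>X. X $$ (i,j)"] S by auto
    qed (use S in auto)
  next
    assume "dephase_a da db ?S = ?S"
    then show "hs2 (?S - dephase_a da db ?S) = 0" using S by (simp add: hs2_def)
  qed
  \<comment> \<open>Products of block diagonal matrices are block diagonal, which gives one
    direction; \<open>dephase_msqrt\<close> gives the other.\<close>
  also have "\<dots> \<longleftrightarrow> dephase_a da db \<rho> = \<rho>"
    using dephase_mult[OF S _ S] dephase_msqrt[OF \<rho>(1)] msqrt(2)[OF \<rho>(1)] by auto
  finally show "block_weight da db \<rho> = 1 \<longleftrightarrow> \<rho> \<in> IP da db" using assms by (simp add: IP_def)
qed

lemma sum_sqrt_mult_le:
  fixes a b :: "'i \<Rightarrow> real"
  assumes "\<And>i. i \<in> I \<Longrightarrow> a i \<ge> 0" "\<And>i. i \<in> I \<Longrightarrow> b i \<ge> 0"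
  shows "(\<Sum>i\<in>I. sqrt (a i) * sqrt (b i)) \<le> sqrt (\<Sum>i\<in>I. a i) * sqrt (\<Sum>i\<in>I. b i)"
  using L2_set_mult_ineq[of "\<lambda>i. sqrt (a i)" "\<lambda>i. sqrt (b i)" I] assms
  by (simp add: L2_set_def)

text \<open>Removes the normalisation from the defining property, so that zero outcomes are covered
  as well.\<close>

lemma PIO_preserves_block:
  assumes K: "PIO da db r K" and k: "k < r" and \<sigma>: "\<sigma> \<in> IP da db"
  shows "dephase_a da db (K k * \<sigma> * dagger (K k)) = K k * \<sigma> * dagger (K k)"
proof -
  let ?N = "da * db" and ?T = "K k * \<sigma> * dagger (K k)"
  have Kc: "K k \<in> carrier_mat ?N ?N" using K k by (simp add: PIO_def kraus_def)
  have T: "?T \<in> carrier_mat ?N ?N" using Kc \<sigma> by (auto simp: IP_def density_def psd_def)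
  show ?thesis
  proof (cases "?T = 0\<^sub>m ?N ?N")
    case True
    then show ?thesis by (intro dephase_eqI) auto
  next
    case False
    define c where "c = 1 / Re (mtrace ?T)"
    have "of_real c \<cdot>\<^sub>m ?T \<in> IP da db" using K k \<sigma> False by (simp add: PIO_def c_def)
    then have c: "mtrace (of_real c \<cdot>\<^sub>m ?T) = 1" "dephase_a da db (of_real c \<cdot>\<^sub>m ?T) = of_real c \<cdot>\<^sub>m ?T"
      by (auto simp: IP_def density_def)
    \<comment> \<open>The scaled matrix has trace 1, so the scale cannot be zero.\<close>
    have "c \<noteq> 0" using c(1) mtrace_smult[OF T] by auto
    show ?thesis
    proof (rule dephase_eqI[OF T])
      fix i j assume ij: "i < ?N" "j < ?N" "i div db \<noteq> j div db"
      then have "(of_real c \<cdot>\<^sub>m ?T) $$ (i,j) = 0" using dephase_eqD[OF _ c(2)] T by simp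
      moreover have "(of_real c \<cdot>\<^sub>m ?T) $$ (i,j) = of_real c * ?T $$ (i,j)"
        by (rule index_smult_mat) (use ij(1,2) carrier_matD[OF T] in linarith)+
      ultimately show "?T $$ (i,j) = 0" using \<open>c \<noteq> 0\<close> by (metis mult_eq_0_iff of_real_eq_0_iff)
    qed
  qed
qed

lemma kraus_trace:
  assumes K: "kraus n r K" and A: "A \<in> carrier_mat n n"
  shows "(\<Sum>k<r. mtrace (K k * A * dagger (K k))) = mtrace A"
proof -
  have Kc: "K k \<in> carrier_mat n n" if "k < r" for k using K that by (simp add: kraus_def)
  have "(\<Sum>k<r. mtrace (K k * A * dagger (K k))) = (\<Sum>k<r. mtrace (A * (dagger (K k) * K k) * 1\<^sub>m n))"
  proof (rule sum.cong[OF refl])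
    fix k assume "k \<in> {..<r}"
    then have k: "K k \<in> carrier_mat n n" using Kc by simp
    have "mtrace (K k * (A * dagger (K k))) = mtrace (A * dagger (K k) * K k)"
      by (rule mtrace_mult_comm) (use k A in auto)
    then show "mtrace (K k * A * dagger (K k)) = mtrace (A * (dagger (K k) * K k) * 1\<^sub>m n)"
      using k A right_mult_one_mat[of "A * (dagger (K k) * K k)" n n] by (simp add: assoc_square[of _ n])
  qed
  also have "\<dots> = mtrace (A * mat_sum n {..<r} (\<lambda>k. dagger (K k) * K k) * 1\<^sub>m n)"
    using A Kc by (subst mtrace_conj_mat_sum) auto
  also have "\<dots> = mtrace A" using A K by (simp add: kraus_def)
  finally show ?thesis .
qed

text \<open>Take the optimal \<open>\<sigma>\<close>. Kraus monotonicity splits its affinity over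
  the outcomes, each of which is bounded by its own weight and by the trace \<open>t k\<close> of
  the block diagonal outcome of \<open>\<sigma>\<close>. Cauchy-Schwarz finishes, as the
  \<open>t k\<close> sum to 1.\<close>

lemma block_weight_PIO:
  assumes K: "PIO da db r K" and \<rho>: "density (da * db) \<rho>"
  shows "block_weight da db \<rho> \<le> (\<Sum>k<r. block_weight da db (K k * \<rho> * dagger (K k)))"
proof -
  let ?N = "da * db"
  have kr: "kraus ?N r K" using K by (simp add: PIO_def)
  then have Kc: "K k \<in> carrier_mat ?N ?N" if "k < r" for k using that by (simp add: kraus_def)
  have \<rho>p: "psd ?N \<rho>" using \<rho> by (simp add: density_def)
  obtain \<sigma> where \<sigma>: "\<sigma> \<in> IP da db" and opt: "affinity ?N \<rho> \<sigma> = sqrt (block_weight da db \<rho>)"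
    using optimal_state[OF \<rho>] by blast
  have \<sigma>p: "psd ?N \<sigma>" "mtrace \<sigma> = 1" using \<sigma> by (auto simp: IP_def density_def)
  define t where "t k = Re (mtrace (K k * \<sigma> * dagger (K k)))" for k
  have psdK: "psd ?N (K k * \<rho> * dagger (K k))" "psd ?N (K k * \<sigma> * dagger (K k))" if "k < r" for k
    using psd_conj[OF \<rho>p Kc[OF that]] psd_conj[OF \<sigma>p(1) Kc[OF that]] by auto
  have t: "t k \<ge> 0" if "k < r" for k
    using Re_mtrace_psd[OF psdK(2)[OF that]] by (simp add: t_def hs2_nonneg)
  have "(\<Sum>k<r. t k) = Re (mtrace \<sigma>)"
    unfolding t_def by (subst kraus_trace[OF kr psdD(1)[OF \<sigma>p(1)], symmetric]) simp
  then have t1: "(\<Sum>k<r. t k) = 1" using \<sigma>p(2) by simp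
  have "sqrt (block_weight da db \<rho>)
      \<le> (\<Sum>k<r. affinity ?N (K k * \<rho> * dagger (K k)) (K k * \<sigma> * dagger (K k)))"
    unfolding opt[symmetric] by (rule affinity_kraus_mono[OF kr \<rho>p \<sigma>p(1)])
  also have "\<dots> \<le> (\<Sum>k<r. sqrt (block_weight da db (K k * \<rho> * dagger (K k))) * sqrt (t k))"
    unfolding t_def
    by (intro sum_mono affinity_le_block_weight psdK PIO_preserves_block[OF K _ \<sigma>]) auto
  also have "\<dots> \<le> sqrt (\<Sum>k<r. block_weight da db (K k * \<rho> * dagger (K k))) * sqrt (\<Sum>k<r. t k)"
    using t by (intro sum_sqrt_mult_le) (auto simp: block_weight_nonneg)
  finally show ?thesis by (simp add: t1)
qed

text \<open>Superadditivity is applied to the members of the ensemble paired with their witnesses,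
  both scaled by \<open>p i\<close>.\<close>

lemma block_weight_concave:
  assumes p: "\<And>i. i < m \<Longrightarrow> p i \<ge> 0" and A: "\<And>i. i < m \<Longrightarrow> psd (da * db) (A i)"
  shows "(\<Sum>i<m. p i * block_weight da db (A i))
    \<le> block_weight da db (mat_sum (da * db) {..<m} (\<lambda>i. of_real (p i) \<cdot>\<^sub>m A i))"
proof -
  let ?N = "da * db"
  define B where "B i = block_witness da db (A i)" for i
  define x where "x = (\<Sum>i<m. p i * block_weight da db (A i))"
  let ?A = "mat_sum ?N {..<m} (\<lambda>i. of_real (p i) \<cdot>\<^sub>m A i)" and ?B = "mat_sum ?N {..<m} (\<lambda>i. of_real (p i) \<cdot>\<^sub>m B i)"
  note B = block_witness[OF A, folded B_def]
  have psdA: "psd ?N (of_real (p i) \<cdot>\<^sub>m A i)" and psdB: "psd ?N (of_real (p i) \<cdot>\<^sub>m B i)" if "i < m" for i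
    using psd_smult p A B(1) that by auto
  have "x = (\<Sum>i<m. affinity ?N (of_real (p i) \<cdot>\<^sub>m A i) (of_real (p i) \<cdot>\<^sub>m B i))"
    unfolding x_def using affinity_smult[OF A B(1)] B(4) p by (intro sum.cong) auto
  also have "\<dots> \<le> affinity ?N ?A ?B"
    using psdA psdB by (intro affinity_superadditive) auto
  also have "\<dots> \<le> sqrt (block_weight da db ?A) * sqrt (Re (mtrace ?B))"
  proof (rule affinity_le_block_weight)
    show "psd ?N ?A" "psd ?N ?B" using psdA psdB by (auto intro: psd_mat_sum)
    show "dephase_a da db ?B = ?B"
    proof (rule dephase_eqI)
      fix r c assume rc: "r < ?N" "c < ?N" "r div db \<noteq> c div db"
      have "(of_real (p i) \<cdot>\<^sub>m B i) $$ (r,c) = 0" if "i < m" for i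
        using dephase_eqD[OF psdD(1)[OF B(1)] B(2) rc, OF that that] psdD(1)[OF B(1), OF that] rc by simp
      then show "?B $$ (r,c) = 0" using rc by simp
    qed simp
  qed
  also have "Re (mtrace ?B) = x"
    unfolding x_def using psdD(1)[OF psdB] mtrace_smult[OF psdD(1)[OF B(1)]] B(3)
    by (subst mtrace_mat_sum) auto
  \<comment> \<open>The traces of the witnesses are the weights, so \<open>x\<close> reappears on
    the right; dividing by \<open>sqrt x\<close> leaves the claim.\<close>
  finally have le: "x \<le> sqrt (block_weight da db ?A) * sqrt x" .
  have "x \<ge> 0" unfolding x_def using p by (intro sum_nonneg) (simp add: block_weight_nonneg)
  show ?thesis
  proof (cases "x = 0")
    case True
    then show ?thesis unfolding x_def by (simp add: block_weight_nonneg)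
  next
    case False
    then have "sqrt x > 0" using \<open>x \<ge> 0\<close> by simp
    moreover have "sqrt x * sqrt x \<le> sqrt (block_weight da db ?A) * sqrt x" using le \<open>x \<ge> 0\<close> by simp
    ultimately have "sqrt x \<le> sqrt (block_weight da db ?A)" by (rule mult_right_le_imp_le[rotated])
    then show ?thesis unfolding x_def by simp
  qed
qed

section \<open>Mixtures, post-measurement states and the resulting properties of the
  coherence\<close>

lemma density_mixture:
  assumes "\<And>i. i < m \<Longrightarrow> p i \<ge> 0" "\<And>i. i < m \<Longrightarrow> density n (\<rho>s i)" "(\<Sum>i<m. p i) = 1"
  shows "density n (mat_sum n {..<m} (\<lambda>i. of_real (p i) \<cdot>\<^sub>m \<rho>s i))"
proof -
  have psd: "psd n (\<rho>s i)" and tr: "mtrace (\<rho>s i) = 1" if "i < m" for i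
    using assms(2)[OF that] by (auto simp: density_def)
  have "mtrace (mat_sum n {..<m} (\<lambda>i. of_real (p i) \<cdot>\<^sub>m \<rho>s i)) = (\<Sum>i<m. of_real (p i))"
    using psdD(1)[OF psd] mtrace_smult[OF psdD(1)[OF psd]] tr by (subst mtrace_mat_sum) auto
  also have "\<dots> = 1" using assms(3) by (simp flip: of_real_sum)
  finally show ?thesis
    unfolding density_def using assms(1) psd by (intro conjI psd_mat_sum psd_smult) auto
qed

lemma CA_convex:
  assumes "\<And>i. i < m \<Longrightarrow> p i \<ge> 0" "\<And>i. i < m \<Longrightarrow> density (da * db) (\<rho>s i)" "(\<Sum>i<m. p i) = 1"
  shows "CA da db (mat_sum (da * db) {..<m} (\<lambda>i. of_real (p i) \<cdot>\<^sub>m \<rho>s i)) \<le> (\<Sum>i<m. p i * CA da db (\<rho>s i))"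
proof -
  have "(\<Sum>i<m. p i * CA da db (\<rho>s i)) = (\<Sum>i<m. p i) - (\<Sum>i<m. p i * block_weight da db (\<rho>s i))"
    using assms(2) by (simp add: CA_eq right_diff_distrib sum_subtractf)
  moreover have "(\<Sum>i<m. p i * block_weight da db (\<rho>s i))
      \<le> block_weight da db (mat_sum (da * db) {..<m} (\<lambda>i. of_real (p i) \<cdot>\<^sub>m \<rho>s i))"
    using assms by (intro block_weight_concave) (auto simp: density_def)
  ultimately show ?thesis using assms by (simp add: CA_eq density_mixture)
qed

lemma density_normalize:
  assumes A: "psd n A" "Re (mtrace A) > 0"
  shows "density n (of_real (1 / Re (mtrace A)) \<cdot>\<^sub>m A)"
proof -
  define t where "t = Re (mtrace A)"
  have "t > 0" using A(2) by (simp add: t_def)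
  moreover have "mtrace A = of_real t" using mtrace_psd[OF A(1)] by (simp add: t_def)
  ultimately have "mtrace (of_real (1 / t) \<cdot>\<^sub>m A) = 1"
    using mtrace_smult[OF psdD(1)[OF A(1)]] by simp
  then show ?thesis
    unfolding density_def t_def using A by (intro conjI psd_smult) auto
qed

text \<open>The weight is homogeneous of degree one, so each term is the trace of the unnormalised
  outcome minus its weight. The traces sum to 1, and \<open>block_weight_PIO\<close> bounds the
  weights.\<close>

lemma CA_strong_monotone:
  assumes K: "PIO da db r K" and \<rho>: "density (da * db) \<rho>"
  defines "A \<equiv> \<lambda>i. K i * \<rho> * dagger (K i)"
  shows "(\<Sum>i\<in>{i. i < r \<and> Re (mtrace (A i)) > 0}.
    Re (mtrace (A i)) * CA da db (of_real (1 / Re (mtrace (A i))) \<cdot>\<^sub>m A i)) \<le> CA da db \<rho>"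
proof -
  let ?N = "da * db" and ?I = "{i. i < r \<and> Re (mtrace (A i)) > 0}"
  have kr: "kraus ?N r K" using K by (simp add: PIO_def)
  have \<rho>p: "psd ?N \<rho>" "mtrace \<rho> = 1" using \<rho> by (auto simp: density_def)
  have A: "psd ?N (A i)" if "i < r" for i
    unfolding A_def using kr that by (intro psd_conj \<rho>p) (simp add: kraus_def)
  have A0: "Re (mtrace (A i)) = 0" "A i = 0\<^sub>m ?N ?N" if "i \<in> {..<r} - ?I" for i
  proof -
    have "Re (mtrace (A i)) \<ge> 0" using Re_mtrace_psd[OF A] that by (auto simp: hs2_nonneg)
    then show "Re (mtrace (A i)) = 0" using that by auto
    then show "A i = 0\<^sub>m ?N ?N" using A that by (intro psd_trace_0) auto
  qed
  have W0: "block_weight da db (A i) = 0" if i: "i \<in> {..<r} - ?I" for i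
  proof -
    \<comment> \<open>A zero outcome equals its own multiple by 0, so homogeneity gives weight 0 and
      the sum may run over all outcomes.\<close>
    have "A i = of_real 0 \<cdot>\<^sub>m A i" by (subst (1 2) A0(2)[OF i]) auto
    then show ?thesis using block_weight_smult[OF A, of i 0] i by auto
  qed
  have "(\<Sum>i\<in>?I. Re (mtrace (A i)) * CA da db (of_real (1 / Re (mtrace (A i))) \<cdot>\<^sub>m A i))
      = (\<Sum>i\<in>?I. Re (mtrace (A i)) - block_weight da db (A i))"
  proof (rule sum.cong[OF refl])
    fix i assume i: "i \<in> ?I"
    then show "Re (mtrace (A i)) * CA da db (of_real (1 / Re (mtrace (A i))) \<cdot>\<^sub>m A i)
        = Re (mtrace (A i)) - block_weight da db (A i)"
      using CA_eq[OF density_normalize[OF A]] block_weight_smult[OF A, of i "1 / Re (mtrace (A i))"]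
      by (simp add: right_diff_distrib)
  qed
  also have "\<dots> = (\<Sum>i<r. Re (mtrace (A i)) - block_weight da db (A i))"
    by (rule sum.mono_neutral_left) (use A0(1) W0 in auto)
  also have "\<dots> = Re (mtrace \<rho>) - (\<Sum>i<r. block_weight da db (A i))"
    unfolding sum_subtractf A_def
    by (subst kraus_trace[OF kr psdD(1)[OF \<rho>p(1)], symmetric]) simp
  also have "\<dots> \<le> 1 - block_weight da db \<rho>"
    using block_weight_PIO[OF K \<rho>] \<rho>p(2) by (simp add: A_def)
  finally show ?thesis by (simp add: CA_eq[OF \<rho>])
qed

text \<open>An outcome of probability zero has no post-measurement state, so \<open>\<rho>\<close> takes its place in
  the ensemble to which convexity is applied.\<close>

lemma CA_monotone:
  assumes K: "PIO da db r K" and \<rho>: "density (da * db) \<rho>"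
  shows "CA da db (apply_kraus (da * db) r K \<rho>) \<le> CA da db \<rho>"
proof -
  let ?N = "da * db"
  define A where "A i = K i * \<rho> * dagger (K i)" for i
  define p where "p i = Re (mtrace (A i))" for i
  let ?I = "{i. i < r \<and> Re (mtrace (A i)) > 0}"
  define \<rho>s where "\<rho>s i = (if p i > 0 then of_real (1 / p i) \<cdot>\<^sub>m A i else \<rho>)" for i
  have kr: "kraus ?N r K" using K by (simp add: PIO_def)
  have \<rho>p: "psd ?N \<rho>" "mtrace \<rho> = 1" using \<rho> by (auto simp: density_def)
  have A: "psd ?N (A i)" if "i < r" for i
    unfolding A_def using kr that by (intro psd_conj \<rho>p) (simp add: kraus_def)
  have p: "p i \<ge> 0" if "i < r" for i
    unfolding p_def using Re_mtrace_psd[OF A[OF that]] by (simp add: hs2_nonneg)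
  have "(\<Sum>i<r. p i) = Re (mtrace \<rho>)"
    unfolding p_def A_def by (subst kraus_trace[OF kr psdD(1)[OF \<rho>p(1)], symmetric]) simp
  then have p1: "(\<Sum>i<r. p i) = 1" using \<rho>p(2) by simp
  have \<rho>s: "density ?N (\<rho>s i)" if "i < r" for i
    using density_normalize[OF A[OF that]] \<rho> by (simp add: \<rho>s_def p_def)
  have "apply_kraus ?N r K \<rho> = mat_sum ?N {..<r} (\<lambda>i. of_real (p i) \<cdot>\<^sub>m \<rho>s i)"
    unfolding apply_kraus_def A_def[symmetric]
  proof (rule mat_sum_cong)
    fix i assume "i \<in> {..<r}"
    then have i: "i < r" by simp
    show "A i = of_real (p i) \<cdot>\<^sub>m \<rho>s i"
    proof (cases "p i > 0")
      case True
      then show ?thesis by (auto simp: \<rho>s_def smult_smult_mat intro!: eq_matI simp flip: of_real_mult)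
    next
      case False
      then have "p i = 0" using p[OF i] by simp
      then have "A i = 0\<^sub>m ?N ?N" using psd_trace_0[OF A[OF i]] by (simp add: p_def)
      then show ?thesis using \<open>p i = 0\<close> psdD(1)[OF \<rho>p(1)] by (auto simp: \<rho>s_def)
    qed
  qed
  then have "CA da db (apply_kraus ?N r K \<rho>) \<le> (\<Sum>i<r. p i * CA da db (\<rho>s i))"
    using CA_convex[of r p da db \<rho>s] p \<rho>s p1 by simp
  \<comment> \<open>The stand-ins carry probability zero, so they drop out of the average.\<close>
  also have "\<dots> = (\<Sum>i\<in>?I. p i * CA da db (\<rho>s i))"
    by (rule sum.mono_neutral_right) (use p in \<open>force simp: p_def\<close>)+
  also have "\<dots> = (\<Sum>i\<in>?I. Re (mtrace (A i)) * CA da db (of_real (1 / Re (mtrace (A i))) \<cdot>\<^sub>m A i))"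
    by (intro sum.cong) (auto simp: \<rho>s_def p_def)
  also have "\<dots> \<le> CA da db \<rho>"
    unfolding A_def by (rule CA_strong_monotone[OF K \<rho>])
  finally show ?thesis .
qed

theorem theorem5:
  fixes da db :: nat
  assumes "da \<ge> 1" and "db \<ge> 1"
  shows
  "(\<forall>\<rho>. density (da*db) \<rho> \<longrightarrow>
       CA da db \<rho> \<ge> 0 \<and> (CA da db \<rho> = 0 \<longleftrightarrow> \<rho> \<in> IP da db))
   \<and> (\<forall>r K \<rho>. PIO da db r K \<and> density (da*db) \<rho> \<longrightarrow>
       CA da db (apply_kraus (da*db) r K \<rho>) \<le> CA da db \<rho>)
   \<and> (\<forall>r K \<rho>. PIO da db r K \<and> density (da*db) \<rho> \<longrightarrow>
       (\<Sum>i\<in>{i. i < r \<and> Re (mtrace (K i * \<rho> * dagger (K i))) > 0}.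
          Re (mtrace (K i * \<rho> * dagger (K i))) *
          CA da db (of_real (1 / Re (mtrace (K i * \<rho> * dagger (K i)))) \<cdot>\<^sub>m
                    (K i * \<rho> * dagger (K i))))
       \<le> CA da db \<rho>)
   \<and> (\<forall>m (p :: nat \<Rightarrow> real) \<rho>s.
       (\<forall>i<m. p i \<ge> 0 \<and> density (da*db) (\<rho>s i)) \<and> (\<Sum>i<m. p i) = 1 \<longrightarrow>
       CA da db (mat_sum (da*db) {..<m} (\<lambda>i. of_real (p i) \<cdot>\<^sub>m \<rho>s i))
         \<le> (\<Sum>i<m. p i * CA da db (\<rho>s i)))"
proof (intro conjI allI impI)
  fix \<rho> assume \<rho>: "density (da*db) \<rho>"
  show "CA da db \<rho> \<ge> 0" "CA da db \<rho> = 0 \<longleftrightarrow> \<rho> \<in> IP da db"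
    using CA_eq[OF \<rho>] block_weight_le_1_iff[OF \<rho>] by auto
qed (blast intro: CA_monotone CA_strong_monotone CA_convex)+

end
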